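(* Let $k$ be an integer greater than $1$. Then $\chi(\mathrm{S\text{-}Forb}(C(k,1))\cap\mathcal S)\le\max\{k+1,\,2k-4\}$; that is, every strongly connected digraph containing no subdivision of $C(k,1)$ as a subdigraph has chromatic number at most $\max\{k+1,2k-4\}$.
   Context: Digraphs are finite, without loops or parallel arcs (two opposite arcs between the same two vertices are allowed). The chromatic number $\chi(D)$ of a digraph $D$ is the chromatic number of its underlying undirected graph. The chromatic number $\chi(\mathcal D)$ of a class $\mathcal D$ of digraphs is the smallest $m$ such that $\chi(D)\le m$ for all $D\in\mathcal D$, or $+\infty$ if no such $m$ exists. $\mathcal S$ is the class of strongly connected digraphs. $C(k,\ell)$ is the oriented cycle with two blocks of lengths $k$ and $\ell$: the union of two internally disjoint directed paths with the same initial vertex and the same terminal vertex (distinct from the initial vertex), one of length $k$ and one of length $\ell$. A subdivision of a digraph $F$ is obtained from $F$ by replacing each arc $uv$ by a directed $(u,v)$-path of length at least $1$, these paths being pairwise internally disjoint with new internal vertices. $\mathrm{S\text{-}Forb}(F)$ is the class of digraphs containing no subdivision of $F$ as a subdigraph. *)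

theory Defs
  imports "Graph_Theory.Graph_Theory" "HOL-Library.Extended_Nat"
begin

definition proper_colouring :: "('a, 'b) pre_digraph \<Rightarrow> nat \<Rightarrow> ('a \<Rightarrow> nat) \<Rightarrow> bool" where
  "proper_colouring G m c \<longleftrightarrow>
     (\<forall>v \<in> verts G. c v < m) \<and> (\<forall>u v. u \<rightarrow>\<^bsub>G\<^esub> v \<longrightarrow> c u \<noteq> c v)"

text \<open>
  The underlying undirected graph of \<open>D\<close> is represented by its symmetrisation
  \<^const>\<open>mk_symmetric\<close>. The minimum exists whenever \<open>D\<close> is a finite loopless digraph.
\<close>
definition chromatic_number :: "('a, 'b) pre_digraph \<Rightarrow> nat" where
  "chromatic_number D = (LEAST m. \<exists>c. proper_colouring (with_proj (mk_symmetric D)) m c)"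

text \<open>The infimum of the empty set of type \<^typ>\<open>enat\<close> is \<open>\<infinity>\<close>.\<close>
definition class_chromatic_number :: "('a, 'b) pre_digraph set \<Rightarrow> enat" where
  "class_chromatic_number \<D> = Inf {enat m | m. \<forall>D \<in> \<D>. chromatic_number D \<le> m}"

definition strong_digraphs :: "('a, 'b) pre_digraph set" where
  "strong_digraphs = {D. digraph D \<and> strongly_connected D}"

text \<open>
  The two blocks are the directed paths \<open>0, 1, \<dots>, k\<close> and \<open>0, k + 1, \<dots>, k + l - 1, k\<close>,
  both from \<open>0\<close> to \<open>k\<close>. Meaningful for \<open>k, l \<ge> 1\<close> not both equal to \<open>1\<close>
  (otherwise the two blocks would be parallel arcs).
\<close>
definition two_block_cycle :: "nat \<Rightarrow> nat \<Rightarrow> (nat, nat \<times> nat) pre_digraph" where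
  "two_block_cycle k l = with_proj \<lparr>
     pverts = {0..<k + l},
     parcs = set (vwalk_arcs [0..<k + 1]) \<union> set (vwalk_arcs (0 # [k + 1..<k + l] @ [k])) \<rparr>"

definition internal_verts :: "('a, 'b) pre_digraph \<Rightarrow> 'a \<Rightarrow> 'b awalk \<Rightarrow> 'a set" where
  "internal_verts G u p = set (butlast (tl (pre_digraph.awalk_verts G u p)))"

text \<open>
  \<open>\<phi>\<close> embeds the vertices of \<open>F\<close> and \<open>P a\<close> is the directed path of \<open>H\<close> replacing the arc
  \<open>a\<close> of \<open>F\<close>. Distinct paths never share an arc, because \<open>F\<close> and \<open>H\<close> have no parallel arcs.
  This is the directed notion; the constant \<^const>\<open>subdivision\<close> treats
  undirected graphs, modelled as bidirected digraphs.
\<close>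
definition is_subdivision_of :: "('a, 'b) pre_digraph \<Rightarrow> ('c, 'd) pre_digraph \<Rightarrow> bool" where
  "is_subdivision_of H F \<longleftrightarrow> digraph H \<and> digraph F \<and>
     (\<exists>\<phi> P. inj_on \<phi> (verts F) \<and>
        (\<forall>a \<in> arcs F. pre_digraph.apath H (\<phi> (tail F a)) (P a) (\<phi> (head F a)) \<and>
            length (P a) \<ge> 1 \<and>
            internal_verts H (\<phi> (tail F a)) (P a) \<inter> \<phi> ` verts F = {}) \<and>
        (\<forall>a \<in> arcs F. \<forall>b \<in> arcs F. a \<noteq> b \<longrightarrow>
            internal_verts H (\<phi> (tail F a)) (P a) \<inter> internal_verts H (\<phi> (tail F b)) (P b) = {}) \<and>
        verts H = \<phi> ` verts F \<union> (\<Union>a \<in> arcs F. internal_verts H (\<phi> (tail F a)) (P a)) \<and>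
        arcs H = (\<Union>a \<in> arcs F. set (P a)))"

definition S_Forb :: "('c, 'd) pre_digraph \<Rightarrow> ('a, 'b) pre_digraph set" where
  "S_Forb F = {D. digraph D \<and> \<not> (\<exists>H. subgraph H D \<and> is_subdivision_of H F)}"

lemma class_chromatic_number_le_iff:
  "class_chromatic_number \<D> \<le> enat m \<longleftrightarrow> (\<forall>D \<in> \<D>. chromatic_number D \<le> m)"
proof
  assume le: "class_chromatic_number \<D> \<le> enat m"
  let ?X = "{enat m | m. \<forall>D \<in> \<D>. chromatic_number D \<le> m}"
  have "?X \<noteq> {}"
  proof
    assume "?X = {}"
    with le show False
      unfolding class_chromatic_number_def by (simp only: Inf_enat_def) simp
  qed
  then have "Inf ?X \<in> ?X"
    unfolding Inf_enat_def by (smt (verit) LeastI all_not_in_conv)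
  with le show "\<forall>D \<in> \<D>. chromatic_number D \<le> m"
    by (fastforce simp: class_chromatic_number_def)
next
  assume "\<forall>D \<in> \<D>. chromatic_number D \<le> m"
  then show "class_chromatic_number \<D> \<le> enat m"
    by (auto simp: class_chromatic_number_def intro: Inf_lower)
qed

lemma vwalk_arcs_conv_nth:
  "set (vwalk_arcs xs) = {(xs ! i, xs ! Suc i) | i. Suc i < length xs}"
proof (induction xs rule: vwalk_arcs.induct)
  case (3 x y xs)
  have "{((x # y # xs) ! i, (x # y # xs) ! Suc i) | i. Suc i < length (x # y # xs)} =
      insert (x, y) {((y # xs) ! i, (y # xs) ! Suc i) | i. Suc i < length (y # xs)}" (is "?L = ?R")
  proof
    show "?L \<subseteq> ?R"
    proof
      fix e assume "e \<in> ?L"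
      then obtain i where "e = ((x # y # xs) ! i, (x # y # xs) ! Suc i)"
        "Suc i < length (x # y # xs)" by blast
      then show "e \<in> ?R" by (cases i) auto
    qed
    show "?R \<subseteq> ?L"
    proof
      fix e assume "e \<in> ?R"
      then consider "e = (x, y)"
        | i where "e = ((y # xs) ! i, (y # xs) ! Suc i)" "Suc i < length (y # xs)" by blast
      then show "e \<in> ?L"
      proof cases
        case 1
        then show ?thesis by (intro CollectI exI[of _ 0]) auto
      next
        case (2 i)
        then show ?thesis by (intro CollectI exI[of _ "Suc i"]) auto
      qed
    qed
  qed
  with 3 show ?case by simp
qed auto

lemma digraph_two_block_cycle:
  assumes "k \<ge> 1" "l \<ge> 1"
  shows "digraph (two_block_cycle k l)"
proof -
  have arcs_in: "set (vwalk_arcs xs) \<subseteq> {(u, v). u \<in> set xs \<and> v \<in> set xs \<and> u \<noteq> v}"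
    if "distinct xs" for xs :: "nat list"
    using that by (auto simp: vwalk_arcs_conv_nth nth_eq_iff_index_eq)
  have "set (vwalk_arcs [0..<k + 1]) \<subseteq> {(u, v). u < k + l \<and> v < k + l \<and> u \<noteq> v}"
    using arcs_in[of "[0..<k + 1]"] assms by auto
  moreover have "set (vwalk_arcs (0 # [k + 1..<k + l] @ [k])) \<subseteq>
      {(u, v). u < k + l \<and> v < k + l \<and> u \<noteq> v}"
    using arcs_in[of "0 # [k + 1..<k + l] @ [k]"] assms by fastforce
  ultimately have "pair_digraph \<lparr>pverts = {0..<k + l},
      parcs = set (vwalk_arcs [0..<k + 1]) \<union> set (vwalk_arcs (0 # [k + 1..<k + l] @ [k]))\<rparr>"
    by unfold_locales auto
  then interpret pair_digraph "\<lparr>pverts = {0..<k + l},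
      parcs = set (vwalk_arcs [0..<k + 1]) \<union> set (vwalk_arcs (0 # [k + 1..<k + l] @ [k]))\<rparr>" .
  show ?thesis
    unfolding two_block_cycle_def by unfold_locales
qed

end

theory Submission
  imports Defs
begin

text \<open>
  A subdivision of \<open>C(k, 1)\<close> is a pair of internally disjoint directed paths with common distinct
  ends, one of them with at least \<open>k\<close> arcs; it is called a theta below. Let \<open>m\<close> be the maximum
  of \<open>k + 1\<close> and \<open>2 * k - 4\<close>. By induction on the number of vertices, every strong digraph
  without thetas is \<open>m\<close>-colourable (\<open>strong_theta_free_colourable\<close>).

  By Bondy's theorem (\<open>colourable_if_dicycles_short\<close>), a strong digraph that is not
  \<open>m\<close>-colourable has a directed cycle \<open>c\<close> with more than \<open>m\<close> vertices, in particular with at least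
  \<open>2 * k - 3\<close>. Any two vertices of \<open>c\<close> are then joined by a segment of \<open>c\<close> with at least \<open>k - 1\<close>
  arcs, in one of the two directions. If a vertex outside \<open>c\<close> could be reached from two vertices
  of \<open>c\<close> by paths outside \<open>c\<close>, such a segment would extend to the long block of a theta
  (\<open>unique_entry\<close>). So a vertex outside \<open>c\<close> is reached from just one vertex \<open>s\<close> of \<open>c\<close> and,
  dually, reaches just one vertex \<open>t\<close> of \<open>c\<close>, and the outside vertices with the same \<open>s\<close> and \<open>t\<close>
  are attached to the rest at \<open>s\<close> and \<open>t\<close> only. This cuts the digraph in two. After one side
  has been replaced by an arc for a path through it, the other side is a smaller strong digraph
  without thetas. The arcs force \<open>s\<close> and \<open>t\<close> to have different colours if they are different,
  so the colourings of the two sides fit together (\<open>colourable_if_outside\<close>).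

  It remains that \<open>c\<close> is Hamiltonian. Two crossing chords of \<open>c\<close> form thetas that go round the
  cycle, so crossing chords must span a long part of \<open>c\<close>, while each chord spans at most \<open>k - 1\<close>
  arcs. Therefore the first vertex below a shortest chord has at most \<open>k\<close> neighbours
  (\<open>low_degree\<close>). That vertex is removed, its neighbours on the cycle are joined by an arc, and
  the colouring of the smaller digraph is extended (\<open>colourable_if_hamiltonian\<close>).
\<close>

section \<open>Paths, cycles and thetas in a relation\<close>

definition dipath :: "'a rel \<Rightarrow> 'a list \<Rightarrow> bool" where
  "dipath E p \<longleftrightarrow> distinct p \<and> successively (\<lambda>x y. (x, y) \<in> E) p"

definition dicycle :: "'a rel \<Rightarrow> 'a list \<Rightarrow> bool" where
  "dicycle E c \<longleftrightarrow> c \<noteq> [] \<and> dipath E c \<and> (last c, hd c) \<in> E"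

text \<open>
  A subdivision of \<open>C(k, 1)\<close>, as a pair of paths in the arc relation: the path through \<open>xs\<close>
  has \<open>Suc (length xs)\<close> arcs and takes the place of the block of length \<open>k\<close>; \<open>ys = []\<close> means
  that the other block stays a single arc. For \<open>k \<ge> 2\<close> the long path is not a single arc,
  so the two paths differ.
\<close>
definition theta :: "nat \<Rightarrow> 'a rel \<Rightarrow> bool" where
  "theta k E \<longleftrightarrow> (\<exists>u xs ys v. dipath E (u # xs @ [v]) \<and> dipath E (u # ys @ [v]) \<and>
     set xs \<inter> set ys = {} \<and> k \<le> Suc (length xs))"

definition strong_on :: "'a set \<Rightarrow> 'a rel \<Rightarrow> bool" where
  "strong_on V E \<longleftrightarrow> (\<forall>u \<in> V. \<forall>v \<in> V. (u, v) \<in> E\<^sup>*)"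

definition colourable :: "'a set \<Rightarrow> 'a rel \<Rightarrow> nat \<Rightarrow> bool" where
  "colourable V E m \<longleftrightarrow> (\<exists>c. (\<forall>v \<in> V. c v < m) \<and> (\<forall>u v. (u, v) \<in> E \<longrightarrow> c u \<noteq> c v))"

lemma thetaI:
  assumes "dipath E (u # xs @ [v])" "dipath E (u # ys @ [v])"
    "set xs \<inter> set ys = {}" "k \<le> Suc (length xs)"
  shows "theta k E"
  using assms unfolding theta_def by blast

lemma dipath_append:
  "dipath E (xs @ ys) \<longleftrightarrow> dipath E xs \<and> dipath E ys \<and> set xs \<inter> set ys = {} \<and>
     (xs = [] \<or> ys = [] \<or> (last xs, hd ys) \<in> E)"
  unfolding dipath_def successively_append_iff by auto

lemma dipath_Cons:
  "dipath E (x # xs) \<longleftrightarrow> x \<notin> set xs \<and> dipath E xs \<and> (xs = [] \<or> (x, hd xs) \<in> E)"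
  unfolding dipath_def successively_Cons by auto

lemma dipath_Nil [simp]: "dipath E []"
  by (simp add: dipath_def)

lemma dipath_mono: "dipath E p \<Longrightarrow> E \<subseteq> F \<Longrightarrow> dipath F p"
  unfolding dipath_def by (auto elim: successively_mono)

lemma dipath_distinct: "dipath E p \<Longrightarrow> distinct p"
  by (simp add: dipath_def)

lemma dipath_subset:
  "dipath E p \<Longrightarrow> E \<subseteq> V \<times> V \<Longrightarrow> p \<noteq> [] \<Longrightarrow> hd p \<in> V \<Longrightarrow> set p \<subseteq> V"
proof (induction p)
  case (Cons x p)
  then show ?case by (cases "p = []") (auto simp: dipath_Cons)
qed simp

lemma dipath_imp_rtrancl:
  "dipath E p \<Longrightarrow> x \<in> set p \<Longrightarrow> (hd p, x) \<in> E\<^sup>* \<and> (x, last p) \<in> E\<^sup>*"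
proof (induction p arbitrary: x)
  case (Cons a p)
  show ?case
  proof (cases "p = []")
    case False
    with Cons.prems have e: "(a, hd p) \<in> E" and p: "dipath E p" by (auto simp: dipath_Cons)
    have "(hd p, last p) \<in> E\<^sup>*" using Cons.IH[OF p, of "hd p"] False by simp
    with e have "(a, last p) \<in> E\<^sup>*" by (simp add: converse_rtrancl_into_rtrancl)
    moreover have "(a, x) \<in> E\<^sup>*" if "x \<in> set p"
      using Cons.IH[OF p that] e by (simp add: converse_rtrancl_into_rtrancl)
    ultimately show ?thesis using Cons.prems(2) Cons.IH[OF p, of x] False by auto
  qed (use Cons.prems in simp)
qed simp

lemma rtrancl_imp_dipath:
  "(u, v) \<in> E\<^sup>* \<Longrightarrow> \<exists>p. p \<noteq> [] \<and> hd p = u \<and> last p = v \<and> dipath E p"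
proof (induction rule: rtrancl_induct)
  case base
  show ?case by (intro exI[of _ "[u]"]) (simp add: dipath_def)
next
  case (step y z)
  then obtain p where p: "p \<noteq> []" "hd p = u" "last p = y" "dipath E p" by blast
  show ?case
  proof (cases "z \<in> set p")
    case True
    then obtain p1 p2 where "p = p1 @ z # p2" by (meson split_list)
    then show ?thesis using p
      by (intro exI[of _ "p1 @ [z]"]) (auto simp: dipath_append dipath_Cons hd_append)
  next
    case False
    then show ?thesis using p step.hyps
      by (intro exI[of _ "p @ [z]"]) (auto simp: dipath_append dipath_Cons)
  qed
qed

lemma dicycle_rotate: "dicycle E (xs @ ys) \<Longrightarrow> dicycle E (ys @ xs)"
  unfolding dicycle_def dipath_append by (cases "xs = []"; cases "ys = []") auto

lemma dicycle_strong: "dicycle E c \<Longrightarrow> strong_on (set c) E"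
  unfolding strong_on_def
proof (intro ballI)
  fix u v assume c: "dicycle E c" and "u \<in> set c" "v \<in> set c"
  then have "(u, last c) \<in> E\<^sup>*" "(last c, hd c) \<in> E" "(hd c, v) \<in> E\<^sup>*"
    using dipath_imp_rtrancl[of E c] by (auto simp: dicycle_def)
  then show "(u, v) \<in> E\<^sup>*" by (meson rtrancl.rtrancl_into_rtrancl rtrancl_trans)
qed

section \<open>Colouring by the circumference\<close>

text \<open>
  A strongly connected digraph whose directed cycles have length at most \<open>m\<close> is \<open>m\<close>-colourable
  (Bondy). Assign an integer index to each arc such that every directed cycle has total index at
  least \<open>1\<close> and every arc lies on a cycle of total index exactly \<open>1\<close>. With arc weights
  \<open>1 - m * index\<close> no cycle has positive weight, so there is a potential \<open>\<pi>\<close> that grows along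
  each arc by at least the weight of the arc. The cycle of index \<open>1\<close> through an arc bounds the
  growth along the arc from above by \<open>m - 1 - m * index\<close>. So the growth is not divisible by \<open>m\<close>,
  and \<open>\<pi> mod m\<close> is the colouring.
\<close>
fun path_weight :: "('a \<times> 'a \<Rightarrow> int) \<Rightarrow> 'a list \<Rightarrow> int" where
  "path_weight w (x # y # p) = w (x, y) + path_weight w (y # p)"
| "path_weight w p = 0"

definition cycle_weight :: "('a \<times> 'a \<Rightarrow> int) \<Rightarrow> 'a list \<Rightarrow> int" where
  "cycle_weight w c = path_weight w c + w (last c, hd c)"

lemma path_weight_append:
  "xs \<noteq> [] \<Longrightarrow> ys \<noteq> [] \<Longrightarrow>
     path_weight w (xs @ ys) = path_weight w xs + w (last xs, hd ys) + path_weight w ys"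
proof (induction w xs rule: path_weight.induct)
  case ("2_2" w x)
  then show ?case by (cases ys) auto
qed auto

lemma cycle_weight_rotate:
  "cycle_weight w (xs @ ys) = cycle_weight w (ys @ xs)"
  by (cases "xs = []"; cases "ys = []") (auto simp: cycle_weight_def path_weight_append)

lemma path_weight_affine:
  "p \<noteq> [] \<Longrightarrow> path_weight (\<lambda>e. 1 - m * i e) p = int (length p) - 1 - m * path_weight i p"
  by (induction i p rule: path_weight.induct) (auto simp: algebra_simps)

lemma path_weight_cong:
  "(\<And>xs x y ys. p = xs @ x # y # ys \<Longrightarrow> w (x, y) = w' (x, y)) \<Longrightarrow> path_weight w p = path_weight w' p"
proof (induction w p rule: path_weight.induct)
  case (1 w x y p)
  have "w (x, y) = w' (x, y)" by (rule 1(2)[of "[]"]) simp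
  moreover have "path_weight w (y # p) = path_weight w' (y # p)"
  proof (rule 1(1))
    fix xs a b ys assume "y # p = xs @ a # b # ys"
    then show "w (a, b) = w' (a, b)" by (intro 1(2)[of "x # xs"]) simp
  qed
  ultimately show ?case by simp
qed auto

text \<open>
  The potential of \<open>v\<close> is the largest weight of a path from the root \<open>r\<close> to \<open>v\<close>. An arc from
  the end of such a path back to one of its vertices closes a cycle, and cutting that cycle off
  does not decrease the weight.
\<close>
lemma feasible_potential:
  fixes w :: "'a \<times> 'a \<Rightarrow> int"
  assumes fin: "finite V" and E: "E \<subseteq> V \<times> V" and r: "r \<in> V"
    and reach: "\<And>v. v \<in> V \<Longrightarrow> (r, v) \<in> E\<^sup>*"
    and cyc: "\<And>c. dicycle E c \<Longrightarrow> cycle_weight w c \<le> 0"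
  obtains \<pi> where "\<And>x y. (x, y) \<in> E \<Longrightarrow> \<pi> x + w (x, y) \<le> \<pi> y"
proof -
  define Q where "Q v = {q. q \<noteq> [] \<and> hd q = r \<and> last q = v \<and> dipath E q}" for v
  define \<pi> where "\<pi> v = Max (path_weight w ` Q v)" for v
  have "Q v \<subseteq> {q. set q \<subseteq> V \<and> distinct q}" for v
    using dipath_subset[OF _ E] r by (auto simp: Q_def dipath_def)
  then have finQ: "finite (Q v)" for v
    using finite_subset_distinct[OF fin] finite_subset by blast
  have le: "path_weight w q \<le> \<pi> v" if "q \<in> Q v" for q v
    unfolding \<pi>_def using that finQ by simp
  have "\<pi> x + w (x, y) \<le> \<pi> y" if xy: "(x, y) \<in> E" for x y
  proof -
    have "Q x \<noteq> {}" using rtrancl_imp_dipath[OF reach] xy E by (fastforce simp: Q_def)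
    then have "\<pi> x \<in> path_weight w ` Q x" unfolding \<pi>_def using finQ by (intro Max_in) auto
    then obtain q where q: "q \<in> Q x" and \<pi>x: "\<pi> x = path_weight w q" by blast
    show ?thesis
    proof (cases "y \<in> set q")
      case False
      then have "q @ [y] \<in> Q y" using q xy by (auto simp: Q_def dipath_append dipath_Cons)
      moreover have "path_weight w (q @ [y]) = \<pi> x + w (x, y)"
        using q \<pi>x by (subst path_weight_append) (auto simp: Q_def)
      ultimately show ?thesis using le[of "q @ [y]" y] by simp
    next
      case True
      then obtain q1 q2 where q12: "q = q1 @ y # q2" by (meson split_list)
      have "dicycle E (y # q2)" using q xy by (auto simp: Q_def dicycle_def dipath_append q12)
      then have neg: "path_weight w (y # q2) + w (x, y) \<le> 0"
        using cyc q by (fastforce simp: cycle_weight_def Q_def q12)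
      have "q1 @ [y] \<in> Q y" using q by (auto simp: Q_def dipath_append dipath_Cons q12 hd_append)
      then have "path_weight w (q1 @ [y]) \<le> \<pi> y" by (rule le)
      moreover have "path_weight w q = path_weight w (q1 @ [y]) + path_weight w (y # q2)"
        unfolding q12 by (cases "q1 = []") (auto simp: path_weight_append)
      ultimately show ?thesis using neg \<pi>x by simp
    qed
  qed
  then show ?thesis by (rule that)
qed

text \<open>
  Among the index functions with values at most \<open>1\<close> that give every cycle index at least \<open>1\<close>,
  take one of smallest total. The index of an arc that lies on no cycle of index \<open>1\<close> could be
  lowered by \<open>1\<close>. The minimum exists because every arc lies on a cycle, so that the other
  arcs of this cycle, of index at most \<open>1\<close>, bound its index from below.
\<close>
lemma cyclic_index:
  assumes fin: "finite V" and E: "E \<subseteq> V \<times> V" and strong: "strong_on V E"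
  obtains i :: "'a \<times> 'a \<Rightarrow> int"
  where "\<And>c. dicycle E c \<Longrightarrow> cycle_weight i c \<ge> 1"
    and "\<And>x y. (x, y) \<in> E \<Longrightarrow>
           \<exists>c. dicycle E c \<and> hd c = y \<and> last c = x \<and> cycle_weight i c = 1"
proof -
  have finE: "finite E" using fin E finite_subset by blast
  have cyc_through: "\<exists>c. dicycle E c \<and> hd c = y \<and> last c = x" if "(x, y) \<in> E" for x y
  proof -
    from that E strong have "(y, x) \<in> E\<^sup>*" by (auto simp: strong_on_def)
    then show ?thesis using rtrancl_imp_dipath that by (fastforce simp: dicycle_def)
  qed
  have len: "length c \<le> card V" if "dicycle E c" for c
  proof -
    have "hd c \<in> V" using that E by (auto simp: dicycle_def)
    then have "set c \<subseteq> V" using that dipath_subset[OF _ E] by (auto simp: dicycle_def)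
    then show ?thesis using that fin card_mono distinct_card
      by (metis dicycle_def dipath_def)
  qed
  have weight_le: "path_weight i p \<le> int (length p)" if "\<forall>e. i e \<le> 1" for i :: "'a \<times> 'a \<Rightarrow> int" and p
    using that
  proof (induction i p rule: path_weight.induct)
    case (1 w x y p)
    then show ?case using 1(2)[rule_format, of "(x, y)"] by fastforce
  qed auto
  define A where "A i \<longleftrightarrow> (\<forall>e. i e \<le> 1) \<and> (\<forall>c. dicycle E c \<longrightarrow> 1 \<le> cycle_weight i c)"
    for i :: "'a \<times> 'a \<Rightarrow> int"
  have lower: "i e \<ge> - int (card V)" if "A i" "e \<in> E" for i e
  proof -
    obtain x y where e: "e = (x, y)" by (cases e)
    with that obtain c where c: "dicycle E c" "hd c = y" "last c = x"
      using cyc_through by blast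
    have "1 \<le> cycle_weight i c" using that c by (simp add: A_def)
    moreover have "path_weight i c \<le> int (card V)"
      using weight_le[of i c] len[OF c(1)] that by (auto simp: A_def)
    ultimately show ?thesis using c by (simp add: cycle_weight_def e)
  qed
  \<comment> \<open>The shift by \<open>card V\<close> makes the total a natural number, by the lower bound just shown.\<close>
  define M where "M i = nat (\<Sum>e\<in>E. i e + int (card V))" for i :: "'a \<times> 'a \<Rightarrow> int"
  have "path_weight (\<lambda>_. 1) p \<ge> 0" for p :: "'a list"
    by (induction "\<lambda>_ :: 'a \<times> 'a. 1 :: int" p rule: path_weight.induct) auto
  then have "A (\<lambda>_. 1)" by (auto simp: A_def cycle_weight_def)
  then obtain i where i: "A i" and min: "\<And>j. A j \<Longrightarrow> M i \<le> M j"
    using ex_has_least_nat[of A "\<lambda>_. 1" M] by blast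
  have "\<exists>c. dicycle E c \<and> hd c = y \<and> last c = x \<and> cycle_weight i c = 1" if xy: "(x, y) \<in> E" for x y
  proof -
    define j where "j = i((x, y) := i (x, y) - 1)"
    have j: "j e \<le> i e" for e by (simp add: j_def)
    have "\<not> A j"
    proof
      assume "A j"
      have "(\<Sum>e\<in>E. j e + int (card V)) < (\<Sum>e\<in>E. i e + int (card V))"
        using j xy finE by (intro sum_strict_mono_ex1) (auto simp: j_def)
      moreover have "(\<Sum>e\<in>E. j e + int (card V)) \<ge> 0"
        using lower[OF \<open>A j\<close>] by (intro sum_nonneg) fastforce
      ultimately have "M j < M i" by (simp add: M_def)
      with min[OF \<open>A j\<close>] show False by simp
    qed
    moreover have "\<forall>e. j e \<le> 1" using i j order_trans by (fastforce simp: A_def)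
    ultimately obtain c where c: "dicycle E c" and cj: "cycle_weight j c \<le> 0"
      by (fastforce simp: A_def)
    have ci: "cycle_weight i c \<ge> 1" using c i by (simp add: A_def)
    have "\<exists>c. dicycle E c \<and> cycle_weight j c \<le> 0 \<and> hd c = y \<and> last c = x"
    proof (cases "last c = x \<and> hd c = y")
      case False
      have "\<exists>c1 c2. c = c1 @ x # y # c2"
      proof (rule ccontr)
        assume "\<not> ?thesis"
        then have "path_weight i c = path_weight j c"
          by (intro path_weight_cong) (auto simp: j_def)
        with False ci cj show False by (auto simp: cycle_weight_def j_def)
      qed
      then obtain c1 c2 where "c = (c1 @ [x]) @ (y # c2)" by auto
      then have "dicycle E ((y # c2) @ (c1 @ [x]))" "cycle_weight j ((y # c2) @ (c1 @ [x])) \<le> 0"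
        using c cj dicycle_rotate cycle_weight_rotate by metis+
      then show ?thesis by (intro exI[of _ "(y # c2) @ (c1 @ [x])"]) simp
    qed (use c cj in auto)
    then obtain d where d: "dicycle E d" "cycle_weight j d \<le> 0" "hd d = y" "last d = x" by blast
    have "path_weight i d = path_weight j d"
    proof (rule path_weight_cong)
      fix xs a b ys assume ab: "d = xs @ a # b # ys"
      then have "last d = last (b # ys)" by simp
      then have "last d \<in> set (b # ys)" by (metis last_in_set list.distinct(1))
      moreover have "a \<notin> set (b # ys)" using d(1) ab by (simp add: dicycle_def dipath_def)
      ultimately have "a \<noteq> x" using d by blast
      then show "i (a, b) = j (a, b)" by (simp add: j_def)
    qed
    then have "cycle_weight i d \<le> 1" using d by (simp add: cycle_weight_def j_def)
    moreover have "cycle_weight i d \<ge> 1" using d i by (simp add: A_def)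
    ultimately show ?thesis using d by auto
  qed
  with i show ?thesis using that by (auto simp: A_def)
qed

theorem colourable_if_dicycles_short:
  fixes E :: "'a rel"
  assumes fin: "finite V" and E: "E \<subseteq> V \<times> V" and irr: "irrefl E" and strong: "strong_on V E"
    and m: "m \<ge> 1" and short: "\<And>c. dicycle E c \<Longrightarrow> length c \<le> m"
  shows "colourable V E m"
proof (cases "V = {}")
  case True
  with E show ?thesis by (auto simp: colourable_def)
next
  case False
  then obtain r where r: "r \<in> V" by blast
  obtain i :: "'a \<times> 'a \<Rightarrow> int"
    where pos: "\<And>c. dicycle E c \<Longrightarrow> cycle_weight i c \<ge> 1"
      and tight: "\<And>x y. (x, y) \<in> E \<Longrightarrow>
           \<exists>c. dicycle E c \<and> hd c = y \<and> last c = x \<and> cycle_weight i c = 1"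
    using cyclic_index[OF fin E strong] by blast
  define w where "w = (\<lambda>e. 1 - int m * i e)"
  have pw: "path_weight w c = int (length c) - 1 - int m * path_weight i c" if "c \<noteq> []" for c
    using that unfolding w_def by (rule path_weight_affine)
  have cw: "cycle_weight w c = int (length c) - int m * cycle_weight i c" if "dicycle E c" for c
    using that pw[of c] by (auto simp: cycle_weight_def dicycle_def w_def algebra_simps)
  have "cycle_weight w c \<le> 0" if c: "dicycle E c" for c
  proof -
    have "int m * 1 \<le> int m * cycle_weight i c" using pos[OF c] by (intro mult_left_mono) auto
    with cw[OF c] short[OF c] show ?thesis by simp
  qed
  then obtain \<pi> where \<pi>: "\<And>x y. (x, y) \<in> E \<Longrightarrow> \<pi> x + w (x, y) \<le> \<pi> y"
    using feasible_potential[OF fin E r, of w] strong r by (auto simp: strong_on_def)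
  have along: "\<pi> (hd p) + path_weight w p \<le> \<pi> (last p)" if "p \<noteq> []" "dipath E p" for p
    using that
  proof (induction p rule: induct_list012)
    case (3 x y zs)
    then have "\<pi> x + w (x, y) \<le> \<pi> y" using \<pi> by (simp add: dipath_Cons)
    then show ?case using 3 by (simp add: dipath_Cons)
  qed auto
  have "\<pi> x mod int m \<noteq> \<pi> y mod int m" if xy: "(x, y) \<in> E" for x y
  proof
    assume eq: "\<pi> x mod int m = \<pi> y mod int m"
    \<comment> \<open>\<open>\<delta>\<close> is congruent to \<open>\<pi> y - \<pi> x\<close> modulo \<open>m\<close> and lies strictly between \<open>0\<close> and \<open>m\<close>.\<close>
    define \<delta> where "\<delta> = \<pi> y - \<pi> x + int m * i (x, y)"
    have "\<delta> \<ge> 1" using \<pi>[OF xy] by (simp add: \<delta>_def w_def)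
    obtain c where c: "dicycle E c" "hd c = y" "last c = x" "cycle_weight i c = 1"
      using tight[OF xy] by blast
    have "x \<noteq> y" using xy irr by (auto simp: irrefl_def)
    then have "length c \<ge> 2" using c by (cases c; cases "tl c") (auto simp: dicycle_def)
    moreover have "\<pi> y + path_weight w c \<le> \<pi> x" using along[of c] c by (auto simp: dicycle_def)
    moreover have "path_weight i c = 1 - i (x, y)" using c by (simp add: cycle_weight_def)
    then have "path_weight w c = int (length c) - 1 - int m * (1 - i (x, y))"
      using pw[of c] c by (simp add: dicycle_def)
    ultimately have "\<delta> < int m" by (simp add: \<delta>_def algebra_simps)
    have "int m dvd \<pi> y - \<pi> x" using eq by (metis mod_eq_dvd_iff)
    then have "int m dvd \<delta>" by (simp add: \<delta>_def)
    with \<open>\<delta> \<ge> 1\<close> \<open>\<delta> < int m\<close> show False using zdvd_not_zless[of \<delta> "int m"] by simp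
  qed
  moreover have "nat (\<pi> x mod int m) < m" for x using m by (simp add: nat_less_iff)
  moreover have "nat (a mod int m) = nat (b mod int m) \<longleftrightarrow> a mod int m = b mod int m" for a b
    using m by (simp add: eq_nat_nat_iff)
  ultimately show ?thesis unfolding colourable_def
    by (intro exI[of _ "\<lambda>v. nat (\<pi> v mod int m)"]) auto
qed

section \<open>Replacing a path by an arc\<close>

lemma theta_mono: "theta k E \<Longrightarrow> E \<subseteq> F \<Longrightarrow> theta k F"
  unfolding theta_def by (meson dipath_mono)

lemma dipath_converse: "dipath (E\<inverse>) p \<longleftrightarrow> dipath E (rev p)"
  by (simp add: dipath_def)

lemma dicycle_converse: "dicycle (E\<inverse>) c \<longleftrightarrow> dicycle E (rev c)"
  by (auto simp: dicycle_def dipath_converse hd_rev last_rev)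

lemma theta_converse: "theta k (E\<inverse>) \<Longrightarrow> theta k E"
proof -
  assume "theta k (E\<inverse>)"
  then obtain u xs ys v where "dipath (E\<inverse>) (u # xs @ [v])" "dipath (E\<inverse>) (u # ys @ [v])"
    "set xs \<inter> set ys = {}" "k \<le> Suc (length xs)" unfolding theta_def by blast
  then show ?thesis by (intro thetaI[of E v "rev xs" u "rev ys"]) (auto simp: dipath_converse)
qed

text \<open>
  At most one arc of a path is the new arc \<open>(a, b)\<close>; it is replaced by the path through \<open>zs\<close>,
  and the result is a path again since \<open>zs\<close> avoids the set \<open>W\<close> that contains the given path.
\<close>
lemma dipath_expand_arc:
  assumes p: "dipath F (u # xs @ [v])" and in_W: "set (u # xs @ [v]) \<subseteq> W"
    and F: "F \<subseteq> insert (a, b) E"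
    and zs: "dipath E (a # zs @ [b])" "set zs \<inter> W = {}"
  obtains xs' where "dipath E (u # xs' @ [v])" "length xs \<le> length xs'"
    "xs' = xs \<or> (set xs' = set xs \<union> set zs \<and> (\<exists>p1 p2. u # xs @ [v] = p1 @ a # b # p2))"
proof (cases "\<exists>p1 p2. u # xs @ [v] = p1 @ a # b # p2")
  case False
  have "successively (\<lambda>x y. (x, y) \<in> E) (u # xs @ [v])"
    unfolding successively_conv_nth
  proof (intro allI impI)
    fix i assume i: "Suc i < length (u # xs @ [v])"
    let ?p = "u # xs @ [v]"
    have "?p = take i ?p @ ?p ! i # ?p ! Suc i # drop (Suc (Suc i)) ?p"
      using i by (metis Cons_nth_drop_Suc Suc_lessD append_take_drop_id)
    with False have "(?p ! i, ?p ! Suc i) \<noteq> (a, b)" by (metis prod.inject)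
    moreover have "(?p ! i, ?p ! Suc i) \<in> F"
      using p i unfolding dipath_def successively_conv_nth by blast
    ultimately show "(?p ! i, ?p ! Suc i) \<in> E" using F by blast
  qed
  then have "dipath E (u # xs @ [v])" using p by (simp add: dipath_def)
  then show ?thesis by (intro that[of xs]) auto
next
  case True
  then obtain p1 p2 where p12: "u # xs @ [v] = (p1 @ [a]) @ (b # p2)" by auto
  have noarc: "dipath E q" if "dipath F q" "\<not> (a \<in> set q \<and> b \<in> set q)" for q
    using that F unfolding dipath_def successively_conv_nth
    by (metis (no_types, lifting) Suc_lessD insertE nth_mem prod.inject subsetD)
  have F12: "dipath F (p1 @ [a])" "dipath F (b # p2)" "set (p1 @ [a]) \<inter> set (b # p2) = {}"
    using p unfolding p12 dipath_append by auto
  then have E12: "dipath E (p1 @ [a])" "dipath E (b # p2)" by (auto intro!: noarc)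
  define q where "q = (p1 @ [a]) @ zs @ (b # p2)"
  have W12: "set (p1 @ [a]) \<subseteq> W" "set (b # p2) \<subseteq> W" using in_W unfolding p12 by auto
  have q: "dipath E q"
    using E12 F12(3) zs W12 unfolding q_def dipath_append dipath_Cons[of E a] 
    by (cases "zs = []") (auto simp: dipath_append hd_append)
  have "hd (u # xs @ [v]) = hd q" "last (u # xs @ [v]) = last q" unfolding p12 q_def
    by (auto simp: hd_append)
  then have hl: "hd q = u" "last q = v" by auto
  have "length q = Suc (Suc (length xs)) + length zs"
    using arg_cong[OF p12, of length] by (simp add: q_def)
  moreover have "tl q \<noteq> []" "q \<noteq> []" by (auto simp: q_def) (cases p1; auto)
  ultimately have q_eq: "q = u # (butlast (tl q)) @ [v]" "length (butlast (tl q)) = length xs + length zs"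
    using hl by (auto simp: last_tl) (metis append_butlast_last_id last_tl list.collapse)
  have "set q = set (u # xs @ [v]) \<union> set zs" unfolding p12 q_def by auto
  moreover have "u \<notin> set xs" "v \<notin> set xs" "u \<notin> set zs" "v \<notin> set zs" "u \<noteq> v"
    using p in_W zs by (auto simp: dipath_def)
  moreover have "u \<notin> set (butlast (tl q))" "v \<notin> set (butlast (tl q))"
    using q q_eq(1) by (metis dipath_def distinct.simps(2) distinct_append Un_iff set_append
        disjoint_insert(1) list.set(2))+
  moreover have "set q = insert u (insert v (set (butlast (tl q))))" using q_eq(1)
    by (metis (no_types, lifting) Un_insert_right list.set(1) list.simps(15) set_append sup_bot_right insert_commute)
  ultimately have "set (butlast (tl q)) = set xs \<union> set zs" by auto
  then show ?thesis using that[of "butlast (tl q)"] q q_eq True by simp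
qed

text \<open>
  The induction deletes vertices and adds an arc that stands for a path through the deleted part.
  Expanding the arc to the path again only lengthens a block, so no theta is created. Only one of
  the two blocks contains the arc: a common arc would make up the whole of both blocks, but the
  long one has at least two arcs.
\<close>
lemma theta_expand_arc:
  assumes th: "theta k F" and k: "k \<ge> 2" and FW: "F \<subseteq> W \<times> W" and F: "F \<subseteq> insert (a, b) E"
    and zs: "dipath E (a # zs @ [b])" "set zs \<inter> W = {}"
  shows "theta k E"
proof -
  obtain u xs ys v where p: "dipath F (u # xs @ [v])" "dipath F (u # ys @ [v])"
    and disj: "set xs \<inter> set ys = {}" and len: "k \<le> Suc (length xs)"
    using th unfolding theta_def by blast
  have "u \<in> W" using p(1) FW by (cases xs) (auto simp: dipath_Cons)
  then have W: "set (u # xs @ [v]) \<subseteq> W" "set (u # ys @ [v]) \<subseteq> W"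
    using dipath_subset[OF p(1) FW] dipath_subset[OF p(2) FW] \<open>u \<in> W\<close> by simp_all
  obtain xs' where xs': "dipath E (u # xs' @ [v])" "length xs \<le> length xs'"
    "xs' = xs \<or> (set xs' = set xs \<union> set zs \<and> (\<exists>p1 p2. u # xs @ [v] = p1 @ a # b # p2))"
    by (rule dipath_expand_arc[OF p(1) W(1) F zs])
  obtain ys' where ys': "dipath E (u # ys' @ [v])" "length ys \<le> length ys'"
    "ys' = ys \<or> (set ys' = set ys \<union> set zs \<and> (\<exists>p1 p2. u # ys @ [v] = p1 @ a # b # p2))"
    by (rule dipath_expand_arc[OF p(2) W(2) F zs])
  have not_both: False
    if "u # xs @ [v] = p1 @ a # b # p2" "u # ys @ [v] = q1 @ a # b # q2" for p1 p2 q1 q2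
  proof -
    have ab: "a \<in> {u, v}" "b \<in> {u, v}" using that disj by (metis (no_types, opaque_lifting) IntI
          Un_iff empty_iff in_set_conv_decomp insert_iff list.set(1) list.simps(15) set_append)+
    have d: "distinct (p1 @ a # b # p2)" using p(1) that by (simp add: dipath_def)
    have "last (b # p2) = v" using arg_cong[OF that(1), of last] by simp
    then have v: "v \<in> set (b # p2)" by (metis last_in_set list.distinct(1))
    then have "a = u" using ab d by auto
    moreover have "hd (p1 @ [a]) = u" using arg_cong[OF that(1), of hd] by (cases p1) auto
    ultimately have "p1 = []" using d by (cases p1) auto
    have "b = v" using ab d \<open>a = u\<close> by auto
    then have "p2 = []" using \<open>last (b # p2) = v\<close> d by (cases p2 rule: rev_cases) auto
    with \<open>p1 = []\<close> have "length (u # xs @ [v]) = 2" using that(1) by simp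
    then show False using len k by simp
  qed
  have xsW: "set xs \<subseteq> W" "set ys \<subseteq> W" using W by auto
  consider "xs' = xs" | "ys' = ys" "set xs' = set xs \<union> set zs"
    using xs'(3) ys'(3) not_both by blast
  then have "set xs' \<inter> set ys' = {}"
  proof cases
    case 1
    then have "set ys' \<subseteq> set ys \<union> set zs" using ys'(3) by auto
    with 1 show ?thesis using disj xsW zs(2) by blast
  next
    case 2
    then show ?thesis using disj xsW zs(2) by blast
  qed
  then show ?thesis using xs' ys' len by (intro thetaI[of E u xs' v ys']) auto
qed

text \<open>
  A walk that leaves \<open>W\<close> at \<open>x\<close> and comes back at \<open>y\<close> is replaced by a walk from \<open>x\<close> to \<open>y\<close>
  inside \<open>W\<close>.
\<close>
lemma strong_on_shortcut:
  assumes strong: "strong_on V E" and E: "E \<subseteq> V \<times> V" and W: "W \<subseteq> V" and F: "E \<inter> W \<times> W \<subseteq> F"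
    and bypass: "\<And>x w w' y. x \<in> W \<Longrightarrow> (x, w) \<in> E \<Longrightarrow> w \<notin> W \<Longrightarrow> w' \<notin> W \<Longrightarrow> (w', y) \<in> E \<Longrightarrow> y \<in> W
      \<Longrightarrow> (x, y) \<in> F\<^sup>*"
  shows "strong_on W F"
  unfolding strong_on_def
proof (intro ballI)
  fix u v assume u: "u \<in> W" and "v \<in> W"
  have "(u, v) \<in> E\<^sup>*" using strong W \<open>u \<in> W\<close> \<open>v \<in> W\<close> by (auto simp: strong_on_def)
  then have "(v \<in> W \<longrightarrow> (u, v) \<in> F\<^sup>*) \<and>
    (v \<notin> W \<longrightarrow> (\<exists>x w. x \<in> W \<and> (x, w) \<in> E \<and> w \<notin> W \<and> (u, x) \<in> F\<^sup>*))"
  proof (induction rule: rtrancl_induct)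
    case base
    then show ?case using u by simp
  next
    case (step y z)
    show ?case
    proof (cases "y \<in> W")
      case True
      then show ?thesis using step F by (auto intro: rtrancl_into_rtrancl)
    next
      case False
      then obtain x w where "x \<in> W" "(x, w) \<in> E" "w \<notin> W" "(u, x) \<in> F\<^sup>*" using step by blast
      then show ?thesis using bypass[of x w y z] False step.hyps by (auto intro: rtrancl_trans)
    qed
  qed
  with \<open>v \<in> W\<close> show "(u, v) \<in> F\<^sup>*" by blast
qed

section \<open>Vertices outside a long cycle\<close>

lemma dipath_tl_subset:
  "dipath E (x # p) \<Longrightarrow> E \<subseteq> UNIV \<times> B \<Longrightarrow> set p \<subseteq> B"
  by (induction p arbitrary: x) (auto simp: dipath_Cons[of E])

lemma dicycle_segments:
  assumes c: "dicycle E c" and ab: "a \<in> set c" "b \<in> set c" "a \<noteq> b"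
  obtains as bs where "dipath E (a # as @ [b])" "dipath E (b # bs @ [a])"
    "set c = insert a (insert b (set as \<union> set bs))" "length c = length as + length bs + 2"
proof -
  obtain xs ys where xy: "c = xs @ a # ys" using ab(1) by (meson split_list)
  with ab have "b \<in> set (ys @ xs)" by auto
  then obtain as bs where asbs: "ys @ xs = as @ b # bs" by (meson split_list)
  have "dicycle E ((a # ys) @ xs)" using c unfolding xy by (rule dicycle_rotate)
  then have "dicycle E ((a # as) @ (b # bs))" by (simp add: asbs)
  then have "dipath E (a # as @ [b])" "dipath E (b # bs @ [a])"
    by (auto simp: dicycle_def dipath_append dipath_Cons hd_append split: if_splits)
  moreover have "set c = insert a (set (ys @ xs))" "length c = Suc (length (ys @ xs))"
    by (auto simp: xy)
  then have "set c = insert a (insert b (set as \<union> set bs))" "length c = length as + length bs + 2"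
    by (auto simp: asbs)
  ultimately show ?thesis by (rule that)
qed

text \<open>
  Restricting the heads of the arcs to the complement of \<open>S\<close> means that only the first vertex of
  a walk can lie in \<open>S\<close>.
\<close>
definition entries :: "'a rel \<Rightarrow> 'a set \<Rightarrow> 'a \<Rightarrow> 'a set" where
  "entries E S x = {z \<in> S. (z, x) \<in> (E \<inter> UNIV \<times> (- S))\<^sup>+}"

abbreviation exits :: "'a rel \<Rightarrow> 'a set \<Rightarrow> 'a \<Rightarrow> 'a set" where
  "exits E S x \<equiv> entries (E\<inverse>) S x"

lemma entries_path:
  assumes "z \<in> entries E S x"
  obtains p where "dipath E (z # p)" "p \<noteq> []" "last p = x" "set p \<inter> S = {}"
proof -
  let ?R = "E \<inter> UNIV \<times> (- S)"
  have z: "z \<in> S" and zx: "(z, x) \<in> ?R\<^sup>+" using assms by (auto simp: entries_def)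
  from zx have x: "x \<notin> S" by (auto elim: tranclE)
  obtain q where q: "q \<noteq> []" "hd q = z" "last q = x" "dipath ?R q"
    using rtrancl_imp_dipath[OF trancl_into_rtrancl[OF zx]] by blast
  then obtain p where p: "q = z # p" by (cases q) auto
  have "p \<noteq> []" using q z x p by auto
  then have "set p \<subseteq> - S" using q(4) p dipath_tl_subset[of ?R z p "- S"] by auto
  moreover
  have "dipath E (z # p)" using q(4) p by (auto elim: dipath_mono)
  ultimately show ?thesis using that q p \<open>p \<noteq> []\<close> by auto
qed

lemma entries_nonempty:
  assumes E: "E \<subseteq> V \<times> V" and strong: "strong_on V E" and S: "S \<subseteq> V" "S \<noteq> {}" and x: "x \<in> V" "x \<notin> S"
  shows "entries E S x \<noteq> {}"
proof -
  obtain z0 where "z0 \<in> S" using S by blast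
  then have "(z0, x) \<in> E\<^sup>*" using strong S x by (auto simp: strong_on_def)
  then have "x \<notin> S \<longrightarrow> entries E S x \<noteq> {}"
  proof (induction rule: rtrancl_induct)
    case (step y z)
    show ?case
    proof
      assume z: "z \<notin> S"
      then have yz: "(y, z) \<in> E \<inter> UNIV \<times> (- S)" using step by blast
      show "entries E S z \<noteq> {}"
      proof (cases "y \<in> S")
        case True
        with yz have "y \<in> entries E S z" by (auto simp: entries_def)
        then show ?thesis by blast
      next
        case False
        with step obtain w where "w \<in> entries E S y" by blast
        with yz have "w \<in> entries E S z" by (auto simp: entries_def intro: trancl_into_trancl)
        then show ?thesis by blast
      qed
    qed
  qed (use \<open>z0 \<in> S\<close> in simp)
  with x show ?thesis by blast
qed

lemma entries_step:
  "(x, y) \<in> E \<Longrightarrow> y \<notin> S \<Longrightarrow> entries E S x \<subseteq> entries E S y"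
  by (auto simp: entries_def intro: trancl_into_trancl)

lemma entries_arc:
  "(x, y) \<in> E \<Longrightarrow> y \<notin> S \<Longrightarrow> x \<in> S \<Longrightarrow> x \<in> entries E S y"
  by (auto simp: entries_def)

text \<open>
  Two paths that start in \<open>a\<close> and \<open>b\<close> and run to \<open>x\<close> outside \<open>S\<close> meet for the first time in
  some vertex \<open>y\<close>. Going from \<open>a\<close> to \<open>y\<close> either directly or by way of \<open>b\<close> gives a theta.
\<close>
lemma theta_of_fork:
  assumes as: "dipath E (a # as @ [b])" "set (a # as @ [b]) \<subseteq> S" "k \<le> length as + 2"
    and ent: "a \<in> entries E S x" "b \<in> entries E S x"
  shows "theta k E"
proof -
  obtain p where p: "dipath E (a # p)" "p \<noteq> []" "last p = x" "set p \<inter> S = {}"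
    using entries_path[OF ent(1)] .
  obtain q where q: "dipath E (b # q)" "q \<noteq> []" "last q = x" "set q \<inter> S = {}"
    using entries_path[OF ent(2)] .
  have "\<exists>y \<in> set q. y \<in> set p" using p q last_in_set by metis
  then obtain q1 y q2 where q12: "q = q1 @ y # q2" "y \<in> set p" "\<forall>z \<in> set q1. z \<notin> set p"
    using split_list_first_prop[of q "\<lambda>y. y \<in> set p"] by blast
  then obtain p1 p2 where p12: "p = p1 @ y # p2" by (meson split_list)
  have "dipath E (b # q1 @ [y])" using q(1) q12(1)
    by (auto simp: dipath_Cons dipath_append hd_append split: if_splits)
  then have "dipath E ((a # as @ [b]) @ (q1 @ [y]))"
    using as q(4) q12(1) unfolding dipath_append[of E "a # as @ [b]"]
    by (auto simp: dipath_Cons)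
  moreover have "dipath E (a # p1 @ [y])" using p(1) p12
    by (auto simp: dipath_Cons dipath_append hd_append split: if_splits)
  moreover have "set (as @ b # q1) \<inter> set p1 = {}"
    using as(2) p(4) q12(3) p12 by auto
  ultimately show ?thesis using as(3)
    by (intro thetaI[of E a "as @ b # q1" y p1]) auto
qed

text \<open>
  Two entries cut the cycle into two segments, and by the length of the cycle one of them has at
  least \<open>k - 1\<close> arcs. With one more arc behind it, that segment makes a long block.
\<close>
lemma unique_entry:
  assumes free: "\<not> theta k E" and c: "dicycle E c" "2 * k \<le> length c + 3"
    and ent: "a \<in> entries E (set c) x" "b \<in> entries E (set c) x"
  shows "a = b"
proof (rule ccontr)
  assume "a \<noteq> b"
  have "a \<in> set c" "b \<in> set c" using ent by (auto simp: entries_def)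
  then obtain as bs where "dipath E (a # as @ [b])" "dipath E (b # bs @ [a])"
    "set c = insert a (insert b (set as \<union> set bs))" "length c = length as + length bs + 2"
    using dicycle_segments[OF c(1) _ _ \<open>a \<noteq> b\<close>] by blast
  then show False
    using theta_of_fork[of E a as b "set c" k x] theta_of_fork[of E b bs a "set c" k x] ent free c(2)
    by (cases "k \<le> length as + 2") auto
qed

text \<open>
  The two colourings are matched at \<open>s\<close> and \<open>t\<close> by permuting colours. The arcs added between \<open>s\<close>
  and \<open>t\<close> make this possible: they force different colours on \<open>s \<noteq> t\<close> in both colourings.
\<close>
lemma colourable_glue:
  assumes Y: "Y \<subseteq> V" and st: "s \<in> V - Y" "t \<in> V - Y" and E: "E \<subseteq> V \<times> V"
    and into: "\<And>x y. (x, y) \<in> E \<Longrightarrow> y \<in> Y \<Longrightarrow> x \<notin> Y \<Longrightarrow> x = s"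
    and out: "\<And>x y. (x, y) \<in> E \<Longrightarrow> x \<in> Y \<Longrightarrow> y \<notin> Y \<Longrightarrow> y = t"
    and col1: "colourable (V - Y) F m" "E \<inter> (V - Y) \<times> (V - Y) \<subseteq> F" "s \<noteq> t \<Longrightarrow> (s, t) \<in> F"
    and col2: "colourable (Y \<union> {s, t}) G m" "E \<inter> (Y \<union> {s, t}) \<times> (Y \<union> {s, t}) \<subseteq> G"
      "s \<noteq> t \<Longrightarrow> (t, s) \<in> G"
  shows "colourable V E m"
proof -
  obtain c where c: "\<And>v. v \<in> V - Y \<Longrightarrow> c v < m" "\<And>u v. (u, v) \<in> F \<Longrightarrow> c u \<noteq> c v"
    using col1(1) by (auto simp: colourable_def)
  obtain d where d: "\<And>v. v \<in> Y \<union> {s, t} \<Longrightarrow> d v < m" "\<And>u v. (u, v) \<in> G \<Longrightarrow> d u \<noteq> d v"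
    using col2(1) by (auto simp: colourable_def)
  \<comment> \<open>Two transpositions send the colours of \<open>s\<close> and \<open>t\<close> under \<open>d\<close> to those under \<open>c\<close>.\<close>
  define swap :: "nat \<Rightarrow> nat \<Rightarrow> nat \<Rightarrow> nat"
    where "swap a b x = (if x = a then b else if x = b then a else x)" for a b x
  have swap: "inj (swap a b)" for a b by (auto simp: inj_def swap_def)
  have swap_less: "a < m \<Longrightarrow> b < m \<Longrightarrow> x < m \<Longrightarrow> swap a b x < m" for a b x
    by (simp add: swap_def)
  define f where "f = swap (swap (d s) (c s) (d t)) (c t) \<circ> swap (d s) (c s)"
  have inj: "inj f" unfolding f_def by (intro inj_compose swap)
  have lt: "c s < m" "c t < m" "d s < m" "d t < m" using c(1) d(1) st by auto
  then have f_less: "f x < m" if "x < m" for x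
    using that by (auto simp: f_def intro!: swap_less)
  have neq: "c s = c t \<longleftrightarrow> d s = d t"
    using c(2)[of s t] d(2)[of t s] col1(3) col2(3) by (cases "s = t") auto
  then have f: "f (d s) = c s" "f (d t) = c t" by (auto simp: f_def swap_def)
  define e where "e v = (if v \<in> Y then f (d v) else c v)" for v
  have e': "e v = f (d v)" if "v \<in> Y \<union> {s, t}" for v using that f st by (auto simp: e_def)
  have "e u \<noteq> e v" if uv: "(u, v) \<in> E" for u v
  proof (cases "u \<in> Y \<or> v \<in> Y")
    case True
    then have uvW: "u \<in> Y \<union> {s, t}" "v \<in> Y \<union> {s, t}" using uv into out by blast+
    then have "d u \<noteq> d v" using uv col2(2) d(2) by blast
    then show ?thesis using e'[OF uvW(1)] e'[OF uvW(2)] inj by (simp add: inj_eq)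
  next
    case False
    then have "u \<in> V - Y" "v \<in> V - Y" using uv E by auto
    then show ?thesis using uv col1(2) c(2) by (auto simp: e_def)
  qed
  moreover have "e v < m" if "v \<in> V" for v
    using that c(1) d(1) f_less by (auto simp: e_def)
  ultimately show ?thesis by (auto simp: colourable_def)
qed

definition strong_theta_free :: "nat \<Rightarrow> 'a set \<Rightarrow> 'a rel \<Rightarrow> bool" where
  "strong_theta_free k V E \<longleftrightarrow> finite V \<and> E \<subseteq> V \<times> V \<and> irrefl E \<and> strong_on V E \<and> \<not> theta k E"

text \<open>
  By \<open>unique_entry\<close> for the digraph and for its converse, every vertex outside the cycle has one
  entry and one exit. An arc between two outside vertices makes their entries and exits agree, so
  the set \<open>Y\<close> of all outside vertices with the entry \<open>s\<close> and the exit \<open>t\<close> of \<open>o1\<close> is attached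
  to the rest only at \<open>s\<close> and \<open>t\<close>. Both sides of this cut are completed by an arc that replaces a
  path through the other side: a path from \<open>s\<close> to \<open>t\<close> through \<open>Y\<close>, and the segment of the cycle
  from \<open>t\<close> to \<open>s\<close>. Both are smaller, strong and free of thetas. If \<open>s = t\<close>, the subtraction of
  \<open>Id\<close> leaves out the loop.
\<close>
lemma colourable_if_outside:
  fixes V :: "'a set"
  assumes strong_theta_free: "strong_theta_free k V E" and k: "k \<ge> 2"
    and c: "dicycle E c" "2 * k \<le> length c + 3" "3 \<le> length c"
    and o: "o1 \<in> V" "o1 \<notin> set c"
    and IH: "\<And>(V' :: 'a set) E'. card V' < card V \<Longrightarrow> strong_theta_free k V' E' \<Longrightarrow> colourable V' E' m"
  shows "colourable V E m"
proof -
  have fin: "finite V" and E: "E \<subseteq> V \<times> V" and irr: "irrefl E" and strong: "strong_on V E"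
    and free: "\<not> theta k E" using strong_theta_free by (auto simp: strong_theta_free_def)
  let ?S = "set c"
  have "hd c \<in> V" using c(1) E by (auto simp: dicycle_def)
  then have S: "?S \<subseteq> V" "?S \<noteq> {}" using dipath_subset[OF _ E] c(1) by (auto simp: dicycle_def)
  have Econv: "E\<inverse> \<subseteq> V \<times> V" "strong_on V (E\<inverse>)" "\<not> theta k (E\<inverse>)" "dicycle (E\<inverse>) (rev c)"
    using E strong free c(1) theta_converse[of k E]
    by (auto simp: strong_on_def rtrancl_converse dicycle_converse)
  have ent_ne: "entries E ?S x \<noteq> {}" "exits E ?S x \<noteq> {}" if "x \<in> V - ?S" for x
    using that entries_nonempty[OF E strong S] entries_nonempty[OF Econv(1,2) S] by auto
  have ent_uniq: "a = b" if "a \<in> entries E ?S x" "b \<in> entries E ?S x" for a b x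
    using unique_entry[OF free c(1,2) that] .
  have ex_uniq: "a = b" if "a \<in> exits E ?S x" "b \<in> exits E ?S x" for a b x
    using unique_entry[OF Econv(3,4), of a x b] that c(2) by simp
  obtain s t where s: "s \<in> entries E ?S o1" and t: "t \<in> exits E ?S o1"
    using ent_ne[of o1] o by blast
  have stS: "s \<in> ?S" "t \<in> ?S" using s t by (auto simp: entries_def)
  define Y where "Y = {x \<in> V - ?S. s \<in> entries E ?S x \<and> t \<in> exits E ?S x}"
  have o1Y: "o1 \<in> Y" using s t o by (simp add: Y_def)
  have YV: "Y \<subseteq> V" "Y \<inter> ?S = {}" by (auto simp: Y_def)
  have out: "y = t" if xy: "(x, y) \<in> E" "x \<in> Y" "y \<notin> Y" for x y
  proof (cases "y \<in> ?S")
    case True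
    then have "y \<in> exits E ?S x" using xy YV by (intro entries_arc) auto
    then show ?thesis using xy ex_uniq by (auto simp: Y_def)
  next
    case False
    have "y \<in> V" using xy E by auto
    have "s \<in> entries E ?S y" using entries_step[OF xy(1) False] xy(2) by (auto simp: Y_def)
    moreover obtain z where z: "z \<in> exits E ?S y" using ent_ne(2)[of y] False \<open>y \<in> V\<close> by blast
    have "exits E ?S y \<subseteq> exits E ?S x" using xy YV by (intro entries_step) auto
    then have "z = t" using z xy(2) by (intro ex_uniq[of z x t]) (auto simp: Y_def)
    ultimately have "y \<in> Y" using z False \<open>y \<in> V\<close> by (simp add: Y_def)
    with xy show ?thesis by simp
  qed
  have into: "x = s" if xy: "(x, y) \<in> E" "y \<in> Y" "x \<notin> Y" for x y
  proof (cases "x \<in> ?S")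
    case True
    then have "x \<in> entries E ?S y" using xy YV by (intro entries_arc) auto
    then show ?thesis using xy ent_uniq by (auto simp: Y_def)
  next
    case False
    have "x \<in> V" using xy E by auto
    have "exits E ?S y \<subseteq> exits E ?S x" using xy False by (intro entries_step) auto
    then have "t \<in> exits E ?S x" using xy(2) by (auto simp: Y_def)
    moreover obtain z where z: "z \<in> entries E ?S x" using ent_ne(1)[of x] False \<open>x \<in> V\<close> by blast
    have "entries E ?S x \<subseteq> entries E ?S y" using xy YV by (intro entries_step) auto
    then have "z = s" using z xy(2) by (intro ent_uniq[of z y s]) (auto simp: Y_def)
    ultimately have "x \<in> Y" using z False \<open>x \<in> V\<close> by (simp add: Y_def)
    with xy show ?thesis by simp
  qed
  have stV: "s \<in> V - Y" "t \<in> V - Y" using stS S YV by auto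
  let ?F = "E \<inter> (V - Y) \<times> (V - Y) \<union> ({(s, t)} - Id)"
  let ?W = "Y \<union> {s, t}"
  let ?G = "E \<inter> ?W \<times> ?W \<union> ({(t, s)} - Id)"

  let ?R = "E \<inter> (Y \<union> {s}) \<times> (Y \<union> {t})"
  have from_s: "w \<in> Y \<union> {s} \<and> (w, o1) \<in> ?R\<^sup>*"
    if "(w, o1) \<in> (E \<inter> UNIV \<times> (- ?S))\<^sup>+" for w
    using that
  proof (induction rule: converse_trancl_induct)
    case (base w)
    then show ?case using into[of w o1] o1Y by auto
  next
    case (step w w')
    then have "w' \<in> Y" using stS by auto
    then have "w \<in> Y \<union> {s}" "(w, w') \<in> ?R" using step.hyps into[of w w'] by auto
    with step.IH show ?case by (auto intro: converse_rtrancl_into_rtrancl)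
  qed
  have to_t: "w \<in> Y \<union> {t} \<and> (o1, w) \<in> ?R\<^sup>*"
    if "(w, o1) \<in> (E\<inverse> \<inter> UNIV \<times> (- ?S))\<^sup>+" for w
    using that
  proof (induction rule: converse_trancl_induct)
    case (base w)
    then show ?case using out[of o1 w] o1Y by auto
  next
    case (step w w')
    then have "w' \<in> Y" using stS by auto
    then have "w \<in> Y \<union> {t}" "(w', w) \<in> ?R" using step.hyps out[of w' w] by auto
    with step.IH show ?case by (auto intro: rtrancl_into_rtrancl)
  qed
  have st_R: "(s, t) \<in> ?R\<^sup>*"
    using from_s[of s] to_t[of t] s t by (auto simp: entries_def intro: rtrancl_trans)
  have freeF: "\<not> theta k ?F"
  proof
    assume th: "theta k ?F"
    show False
    proof (cases "s = t")
      case True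
      then show False using theta_mono[OF th, of E] free by auto
    next
      case False
      obtain q where q: "q \<noteq> []" "hd q = s" "last q = t" "dipath ?R q"
        using rtrancl_imp_dipath[OF st_R] by blast
      obtain p where p: "q = s # p @ [t]"
      proof -
        obtain q' where q': "q = s # q'" using q(1,2) by (cases q) auto
        then show ?thesis using that q(3) False by (cases q' rule: rev_cases) auto
      qed
      have qp: "dipath ?R (s # p @ [t])" using q(4) unfolding p .
      have "set (p @ [t]) \<subseteq> Y \<union> {t}" by (rule dipath_tl_subset[OF qp]) auto
      moreover have "t \<notin> set p" using dipath_distinct[OF qp] by simp
      ultimately have "set p \<subseteq> Y" by auto
      have "dipath E (s # p @ [t])" using dipath_mono[OF qp] by auto
      then show False
        using theta_expand_arc[OF th k, of "V - Y" s t E p] \<open>set p \<subseteq> Y\<close> stV free by auto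
    qed
  qed
  have freeG: "\<not> theta k ?G"
  proof
    assume th: "theta k ?G"
    show False
    proof (cases "s = t")
      case True
      then show False using theta_mono[OF th, of E] free by auto
    next
      case False
      then obtain as bs where as: "dipath E (t # as @ [s])"
        "set c = insert t (insert s (set as \<union> set bs))"
        using dicycle_segments[OF c(1) stS(2,1)] by metis
      then have "set as \<inter> ?W = {}" using YV by (auto simp: dipath_def)
      then show False
        using theta_expand_arc[OF th k, of ?W t s E as] as(1) free by auto
    qed
  qed
  have strongF: "strong_on (V - Y) ?F"
  proof (rule strong_on_shortcut[OF strong E])
    fix x w w' y
    assume "x \<in> V - Y" "(x, w) \<in> E" "w \<notin> V - Y" "w' \<notin> V - Y" "(w', y) \<in> E" "y \<in> V - Y"
    then have "x = s" "y = t" using into[of x w] out[of w' y] E by auto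
    then show "(x, y) \<in> ?F\<^sup>*" by (cases "s = t") auto
  qed auto
  have strongG: "strong_on ?W ?G"
  proof (rule strong_on_shortcut[OF strong E])
    fix x w w' y
    assume "x \<in> ?W" "(x, w) \<in> E" "w \<notin> ?W" "w' \<notin> ?W" "(w', y) \<in> E" "y \<in> ?W"
    then have "x \<in> {s, t}" "y \<in> {s, t}" using out[of x w] into[of w' y] by auto
    moreover have "(s, t) \<in> ?G\<^sup>*" using rtrancl_mono[of ?R ?G] st_R by auto
    moreover have "(t, s) \<in> ?G\<^sup>*" by (cases "s = t") auto
    ultimately show "(x, y) \<in> ?G\<^sup>*" by auto
  qed (use stV YV in auto)
  have "strong_theta_free k (V - Y) ?F" "strong_theta_free k ?W ?G"
    using fin stV YV irr strongF strongG freeF freeG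
    by (auto simp: strong_theta_free_def irrefl_def intro: finite_subset)
  moreover have "card (V - Y) < card V" using fin YV o1Y by (intro psubset_card_mono) auto
  moreover have "card ?W < card V"
  proof (intro psubset_card_mono psubsetI)
    have "card ?S = length c" using c(1) by (auto simp: dicycle_def dipath_def distinct_card)
    moreover have "card {s, t} \<le> 2" by (cases "s = t") auto
    ultimately have "\<not> ?S \<subseteq> {s, t}" using c(3) card_mono[of "{s, t}" ?S] by auto
    then show "?W \<noteq> V" using S YV by auto
  qed (use fin stV YV in auto)
  ultimately have "colourable (V - Y) ?F m" "colourable ?W ?G m" using IH by blast+
  then show ?thesis
    using colourable_glue[OF YV(1) stV E into out, where F = ?F and G = ?G and m = m] by auto
qed

section \<open>Hamiltonian digraphs\<close>

lemma dipath_Restr: "dipath E p \<Longrightarrow> set p \<subseteq> W \<Longrightarrow> dipath (E \<inter> W \<times> W) p"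
  unfolding dipath_def by (auto elim!: successively_mono)

lemma dicycle_nth:
  assumes "dicycle E c"
  shows "Suc i < length c \<Longrightarrow> (c ! i, c ! Suc i) \<in> E" "(c ! (length c - 1), c ! 0) \<in> E"
  using assms by (auto simp: dicycle_def dipath_def successively_conv_nth last_conv_nth hd_conv_nth)

lemma dicycle_segment:
  assumes "dicycle E c" "j \<le> length c"
  shows "dipath E (map ((!) c) [i..<j])"
  using assms unfolding dicycle_def dipath_def successively_conv_nth distinct_map
  by (auto intro!: inj_on_nth)

lemma dicycle_rotate_by: "dicycle E c \<Longrightarrow> dicycle E (rotate i c)"
  by (metis append_take_drop_id dicycle_rotate rotate_drop_take)

text \<open>A longer chord and the segment of the cycle that it spans form a theta.\<close>
lemma chord_less:
  assumes free: "\<not> theta k E" and c: "dicycle E c"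
    and d: "2 \<le> d" "d < length c" and chord: "(c ! 0, c ! d) \<in> E"
  shows "d < k"
proof (rule ccontr)
  assume "\<not> d < k"
  have seg: "c ! 0 # map ((!) c) [1..<d] @ [c ! d] = map ((!) c) [0..<Suc d]"
    using d by (simp add: upt_conv_Cons)
  have "dipath E (c ! 0 # map ((!) c) [1..<d] @ [c ! d])"
    unfolding seg using d by (intro dicycle_segment[OF c]) simp
  moreover have "c ! 0 \<noteq> c ! d" using c d by (subst nth_eq_iff_index_eq) (auto simp: dicycle_def dipath_def)
  then have "dipath E (c ! 0 # [] @ [c ! d])" using chord by (simp add: dipath_Cons)
  ultimately have "theta k E" using \<open>\<not> d < k\<close> d
    by (intro thetaI[of E "c ! 0" "map ((!) c) [1..<d]" "c ! d" "[]"]) auto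
  with free show False ..
qed

text \<open>
  Rotate the cycle so that a chord \<open>(0, d)\<close> of smallest length starts at position \<open>0\<close>. The
  other chords at position \<open>1\<close> cannot be nested inside it, so each of them crosses it (or, for a
  chord from \<open>d\<close>, touches it), and the theta formed with it by going round the cycle confines the
  other end of the chord. For a chord from position \<open>1\<close> that end lies in \<open>{n + 3 - k .. k}\<close>, which
  is at most one position, and for a chord to position \<open>1\<close> it lies in an interval of at most
  \<open>d - 1\<close> positions. With the two neighbours on the cycle this gives at most \<open>k\<close> neighbours if
  \<open>d \<le> k - 2\<close>. If \<open>d = k - 1\<close>, all chords have this
  length, which leaves at most one in-neighbour and one out-neighbour besides those on the cycle,
  and neither of them if \<open>k = 3\<close>.
\<close>
lemma low_degree:
  assumes free: "\<not> theta k E" and k: "k \<ge> 2" and irr: "irrefl E"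
    and c: "dicycle E c" and E: "E \<subseteq> set c \<times> set c"
    and long: "k + 2 \<le> length c" "2 * k \<le> length c + 3"
  obtains c' where "dicycle E c'" "set c' = set c"
    "card {v. (c' ! 1, v) \<in> E \<or> (v, c' ! 1) \<in> E} \<le> k"
proof -
  define n where "n = length c"
  define H where "H c' \<longleftrightarrow> dicycle E c' \<and> set c' = set c \<and> length c' = n" for c'
  have n: "k + 2 \<le> n" "2 * k \<le> n + 3" "4 \<le> n" using long k by (simp_all add: n_def)
  then have mod: "(n + 1) mod n = 1" by (simp add: mod_Suc)
  have H: "H c" using c by (simp add: H_def n_def)
  have rot: "H (rotate i c')" if "H c'" for i c' using that by (simp add: H_def dicycle_rotate_by)
  define chord_length where "chord_length d \<longleftrightarrow> 2 \<le> d \<and> d < n \<and> (\<exists>c'. H c' \<and> (c' ! 0, c' ! d) \<in> E)" for d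
  \<comment> \<open>A chord is brought to position \<open>0\<close> by rotating the cycle to its tail.\<close>
  have chord: "chord_length e \<and> e < k"
    if "H c'" "i < n" "j < n" "(c' ! i, c' ! j) \<in> E" "2 \<le> e" "e < n" "(i + e) mod n = j" for c' i j e
  proof -
    have "rotate i c' ! 0 = c' ! i" "rotate i c' ! e = c' ! j"
      using that by (auto simp: nth_rotate H_def)
    then have "(rotate i c' ! 0, rotate i c' ! e) \<in> E" using that by simp
    with rot[OF that(1), of i] show ?thesis using that chord_less[OF free, of "rotate i c'" e]
      unfolding chord_length_def H_def by (metis length_rotate)
  qed
  have out: "j = 2 \<or> (3 \<le> j \<and> j \<le> k \<and> chord_length (j - 1))"
    if "H c'" "j < n" "(c' ! 1, c' ! j) \<in> E" for c' j
  proof -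
    have "j \<noteq> 1" using that irr by (auto simp: irrefl_def)
    moreover have "j \<noteq> 0"
    proof
      assume "j = 0"
      have "2 \<le> n - 1" using n by simp
      then have "n - 1 < k" using chord[OF that(1) _ that(2,3), of "n - 1"] \<open>j = 0\<close> by simp
      then show False using n by linarith
    qed
    moreover have "chord_length (j - 1) \<and> j - 1 < k" if "3 \<le> j"
      using chord[OF \<open>H c'\<close> _ \<open>j < n\<close> \<open>(c' ! 1, c' ! j) \<in> E\<close>, of "j - 1"] that \<open>j < n\<close> by auto
    ultimately show ?thesis by (cases "j = 2") auto
  qed
  have inn: "j = 0 \<or> (n + 2 - k \<le> j \<and> j < n \<and> chord_length (n + 1 - j))"
    if "H c'" "j < n" "(c' ! j, c' ! 1) \<in> E" for c' j
  proof -
    have "j \<noteq> 1" using that irr by (auto simp: irrefl_def)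
    moreover have "chord_length (n + 1 - j) \<and> n + 1 - j < k" if "2 \<le> j"
      using chord[OF \<open>H c'\<close> \<open>j < n\<close> _ \<open>(c' ! j, c' ! 1) \<in> E\<close>, of "n + 1 - j"] that \<open>j < n\<close> n mod by simp
    ultimately show ?thesis using that(2) by (cases "j = 0") auto
  qed
  have bound: "card {v. (c' ! 1, v) \<in> E \<or> (v, c' ! 1) \<in> E} \<le> card J"
    if "H c'" "finite J"
      and J: "\<And>j. j < n \<Longrightarrow> (c' ! 1, c' ! j) \<in> E \<or> (c' ! j, c' ! 1) \<in> E \<Longrightarrow> j \<in> J" for c' J
  proof -
    have "{v. (c' ! 1, v) \<in> E \<or> (v, c' ! 1) \<in> E} \<subseteq> (!) c' ` J"
    proof
      fix v assume v: "v \<in> {v. (c' ! 1, v) \<in> E \<or> (v, c' ! 1) \<in> E}"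
      then have "v \<in> set c'" using E that(1) by (auto simp: H_def)
      then obtain j where j: "j < length c'" "c' ! j = v" by (auto simp: in_set_conv_nth)
      then have "j \<in> J" using J[of j] v that(1) by (simp add: H_def)
      then show "v \<in> (!) c' ` J" using j(2) by blast
    qed
    then show ?thesis using surj_card_le[OF that(2)] by blast
  qed
  show ?thesis
  proof (cases "\<exists>d. chord_length d")
    case False
    have "card {v. (c ! 1, v) \<in> E \<or> (v, c ! 1) \<in> E} \<le> card {0 :: nat, 2}"
      using out[OF H] inn[OF H] False by (intro bound[OF H]) auto
    then show ?thesis using that[OF c] k by simp
  next
    case True
    define d where "d = (LEAST d. chord_length d)"
    have "chord_length d" unfolding d_def using True by (metis LeastI)
    have least: "d \<le> e" if "chord_length e" for e unfolding d_def using that by (rule Least_le)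
    from \<open>chord_length d\<close> obtain c' where d: "2 \<le> d" "d < n" and Hc': "H c'" and cd: "(c' ! 0, c' ! d) \<in> E"
      by (auto simp: chord_length_def)
    have c': "dicycle E c'" "length c' = n" "distinct c'" "set c' = set c"
      using Hc' by (auto simp: H_def dicycle_def dipath_def)
    have dk: "d < k" using chord_less[OF free c'(1) d(1)] d cd c' by simp
    have neq: "c' ! i = c' ! j \<longleftrightarrow> i = j" if "i < n" "j < n" for i j
      using nth_eq_iff_index_eq[OF c'(3)] that c'(2) by simp
    \<comment> \<open>From \<open>1\<close> to \<open>d\<close>: along the cycle, or over \<open>j\<close>, round the cycle to \<open>0\<close> and along the chord.\<close>
    have out': "j + k \<ge> n + 3" if j: "d < j" "j < n" and arc: "(c' ! 1, c' ! j) \<in> E" for j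
    proof (rule ccontr)
      assume neg: "\<not> ?thesis"
      have seg: "c' ! 1 # map ((!) c') [2..<d] @ [c' ! d] = map ((!) c') [1..<Suc d]"
        using d by (simp add: upt_conv_Cons numeral_2_eq_2)
      have short: "dipath E (c' ! 1 # map ((!) c') [2..<d] @ [c' ! d])"
        unfolding seg using d c'(2) by (intro dicycle_segment[OF c'(1)]) simp
      have seg2: "dipath E (map ((!) c') [j..<n])" and around: "(c' ! (n - 1), c' ! 0) \<in> E"
        using dicycle_segment[OF c'(1), of n j] dicycle_nth(2)[OF c'(1)] c'(2) by simp_all
      have "last (map ((!) c') [j..<n]) = c' ! (n - 1)" "hd (map ((!) c') [j..<n]) = c' ! j"
        using j by (auto simp: last_map hd_map)
      then have "dipath E (c' ! 1 # (map ((!) c') [j..<n] @ [c' ! 0]) @ [c' ! d])"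
        using seg2 around j d arc cd by (auto simp: dipath_Cons dipath_append neq hd_append)
      then have "theta k E"
      proof (rule thetaI[OF _ short])
        show "set (map ((!) c') [j..<n] @ [c' ! 0]) \<inter> set (map ((!) c') [2..<d]) = {}"
          using j d by (auto simp: neq)
        show "k \<le> Suc (length (map ((!) c') [j..<n] @ [c' ! 0]))"
          using neg j by simp
      qed
      with free show False ..
    qed
    \<comment> \<open>From \<open>0\<close> to \<open>1\<close>: by the arc, or along the chord to \<open>d\<close>, on to \<open>j\<close> and back to \<open>1\<close>.\<close>
    have inn': "j + 3 \<le> k + d" if j: "d \<le> j" "j < n" and arc: "(c' ! j, c' ! 1) \<in> E" for j
    proof (rule ccontr)
      assume neg: "\<not> ?thesis"
      have "(c' ! 0, c' ! 1) \<in> E" using dicycle_nth(1)[OF c'(1), of 0] d c'(2) by simp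
      then have short: "dipath E (c' ! 0 # [] @ [c' ! 1])" using d by (simp add: dipath_Cons neq)
      have seg: "dipath E (map ((!) c') [d..<Suc j])"
        using j c'(2) by (intro dicycle_segment[OF c'(1)]) simp
      have "last (map ((!) c') [d..<Suc j]) = c' ! j" "hd (map ((!) c') [d..<Suc j]) = c' ! d"
        using j by (simp_all del: upt_Suc add: last_map hd_map)
      then have "dipath E (c' ! 0 # map ((!) c') [d..<Suc j] @ [c' ! 1])"
        using seg j d arc cd
        by (auto simp: dipath_Cons dipath_append neq hd_append simp del: upt_Suc)
      then have "theta k E"
        by (rule thetaI[OF _ short]) (use neg j in auto)
      with free show False ..
    qed
    define J where "J = {0, 2} \<union> {n + 2 - k .. min (k + d - 3) (n + 1 - d)} \<union> {n + 3 - k .. k}"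
    have "card {v. (c' ! 1, v) \<in> E \<or> (v, c' ! 1) \<in> E} \<le> card J"
    proof (rule bound[OF Hc'])
      fix j assume j: "j < n" "(c' ! 1, c' ! j) \<in> E \<or> (c' ! j, c' ! 1) \<in> E"
      from j(2) show "j \<in> J"
      proof
        assume arc: "(c' ! 1, c' ! j) \<in> E"
        have "j = 2 \<or> (d < j \<and> j \<le> k)" using out[OF Hc' j(1) arc] least[of "j - 1"] by auto
        then show ?thesis using out'[OF _ j(1) arc] by (auto simp: J_def)
      next
        assume arc: "(c' ! j, c' ! 1) \<in> E"
        have "j = 0 \<or> (n + 2 - k \<le> j \<and> j \<le> n + 1 - d)"
          using inn[OF Hc' j(1) arc] least[of "n + 1 - j"] by auto
        moreover have "d \<le> n + 2 - k" using dk long n_def by simp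
        ultimately show ?thesis using inn'[OF _ j(1) arc] by (auto simp: J_def)
      qed
    qed (simp add: J_def)
    also have "card J \<le> card {0 :: nat, 2} + card {n + 2 - k .. min (k + d - 3) (n + 1 - d)} + card {n + 3 - k .. k}"
      unfolding J_def by (meson add_le_mono1 card_Un_le le_trans)
    also have "\<dots> \<le> k" using long dk d unfolding n_def[symmetric] by (simp add: min_def) arith
    finally show ?thesis using that c' by blast
  qed
qed

lemma colourable_extend:
  assumes E: "E \<subseteq> V \<times> V" "irrefl E" and fin: "finite V" and x: "x \<in> V"
    and col: "colourable (V - {x}) F m" "E \<inter> (V - {x}) \<times> (V - {x}) \<subseteq> F"
    and deg: "card {v. (x, v) \<in> E \<or> (v, x) \<in> E} < m"
  shows "colourable V E m"
proof -
  obtain c where c: "\<And>v. v \<in> V - {x} \<Longrightarrow> c v < m" "\<And>u v. (u, v) \<in> F \<Longrightarrow> c u \<noteq> c v"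
    using col(1) by (auto simp: colourable_def)
  let ?N = "{v. (x, v) \<in> E \<or> (v, x) \<in> E}"
  have "finite ?N" using E fin by (auto intro: finite_subset)
  then have "card (c ` ?N) < card {..<m}" using deg card_image_le[of ?N c] by simp
  then have "\<not> {..<m} \<subseteq> c ` ?N" using card_mono[of "c ` ?N" "{..<m}"] \<open>finite ?N\<close> by auto
  then obtain a where a: "a < m" "a \<notin> c ` ?N" by blast
  have "(c(x := a)) u \<noteq> (c(x := a)) v" if uv: "(u, v) \<in> E" for u v
  proof (cases "u = x \<or> v = x")
    case True
    moreover have "u \<noteq> v" using uv E(2) by (auto simp: irrefl_def)
    ultimately show ?thesis using uv a(2) by auto
  next
    case False
    then show ?thesis using uv E(1) col(2) c(2) by auto
  qed
  moreover have "(c(x := a)) v < m" if "v \<in> V" for v using that a(1) c(1) by auto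
  ultimately show ?thesis unfolding colourable_def by blast
qed

text \<open>
  Deleting a vertex \<open>x\<close> of degree at most \<open>k\<close> and joining its predecessor \<open>u\<close> on the cycle to its
  successor \<open>w\<close> leaves a smaller Hamiltonian digraph without thetas. Each of its colourings
  extends to \<open>x\<close>.
\<close>
lemma colourable_if_hamiltonian:
  fixes V :: "'a set"
  assumes strong_theta_free: "strong_theta_free k V E" and k: "k \<ge> 2" and m: "k < m"
    and c: "dicycle E c" "set c = V" "k + 2 \<le> length c" "2 * k \<le> length c + 3"
    and IH: "\<And>(V' :: 'a set) E'. card V' < card V \<Longrightarrow> strong_theta_free k V' E' \<Longrightarrow> colourable V' E' m"
  shows "colourable V E m"
proof -
  have fin: "finite V" and E: "E \<subseteq> V \<times> V" and irr: "irrefl E" and strong: "strong_on V E"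
    and free: "\<not> theta k E" using strong_theta_free by (auto simp: strong_theta_free_def)
  obtain c' where c': "dicycle E c'" "set c' = V"
    and deg: "card {v. (c' ! 1, v) \<in> E \<or> (v, c' ! 1) \<in> E} \<le> k"
    using low_degree[OF free k irr c(1) _ c(3,4)] E c(2) by blast
  have "length c' = length c" using c c'
    by (metis dicycle_def dipath_def distinct_card)
  then obtain u x w p where p: "c' = u # x # w # p" using c(3) k
    by (cases c'; cases "tl c'"; cases "tl (tl c')") auto
  have x: "x \<in> V" using c'(2) p by auto
  let ?W = "V - {x}"
  let ?F = "E \<inter> ?W \<times> ?W \<union> {(u, w)}"
  have path: "dipath E (u # [x] @ [w])" "u \<noteq> w" "u \<noteq> x" "w \<noteq> x"
    and arcs: "dipath E (w # p)" "u \<notin> set (w # p)" "x \<notin> set (w # p)" "(last c', u) \<in> E"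
    using c'(1) p by (auto simp: dicycle_def dipath_Cons)
  have uw: "u \<in> ?W" "w \<in> ?W" using path c'(2) p by auto
  have Fw: "dipath ?F (w # p)"
  proof -
    have "set (w # p) \<subseteq> ?W" using arcs c'(2) p by auto
    with arcs(1) have "dipath (E \<inter> ?W \<times> ?W) (w # p)" by (rule dipath_Restr)
    then show ?thesis by (rule dipath_mono) auto
  qed
  have "dicycle ?F (u # w # p)"
  proof -
    have "last (w # p) \<in> set (w # p)" using last_in_set[of "w # p"] by blast
    then have "last (w # p) \<in> ?W" using c'(2) p arcs by auto
    then have "(last (w # p), u) \<in> ?F" using arcs(4) p uw by auto
    moreover have "dipath ?F (u # w # p)" using Fw arcs(2) by (simp add: dipath_Cons[of _ u])
    ultimately show ?thesis by (simp add: dicycle_def)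
  qed
  moreover have "set (u # w # p) = ?W" using c' p path arcs by auto
  ultimately have "strong_on ?W ?F" using dicycle_strong by metis
  moreover have "\<not> theta k ?F"
  proof
    assume th: "theta k ?F"
    have "theta k E" by (rule theta_expand_arc[OF th k _ _ path(1), of ?W]) (use uw in auto)
    with free show False ..
  qed
  ultimately have "strong_theta_free k ?W ?F" using fin irr path(2) uw by (auto simp: strong_theta_free_def irrefl_def)
  moreover have "card ?W < card V" using fin x by (intro psubset_card_mono) auto
  ultimately have "colourable ?W ?F m" by (intro IH)
  then show ?thesis
    by (rule colourable_extend[OF E irr fin x]) (use deg m p in auto)
qed

text \<open>
  A digraph that is not colourable has a cycle with more than \<open>max (k + 1) (2 * k - 4)\<close>
  vertices, hence with at least \<open>k + 2\<close> and at least \<open>2 * k - 3\<close>. These are the two bounds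
  on which the analysis of the cycle rests.
\<close>
theorem strong_theta_free_colourable:
  fixes V :: "'a set"
  assumes "strong_theta_free k V E" "k \<ge> 2"
  shows "colourable V E (max (k + 1) (2 * k - 4))"
  using assms
proof (induction "card V" arbitrary: V E rule: less_induct)
  case less
  let ?m = "max (k + 1) (2 * k - 4)"
  have IH: "colourable V' E' ?m" if "card V' < card V" "strong_theta_free k V' E'" for V' :: "'a set" and E'
    using less that by blast
  show ?case
  proof (rule ccontr)
    assume not: "\<not> colourable V E ?m"
    then obtain c where c: "dicycle E c" "length c > ?m"
      using colourable_if_dicycles_short[of V E ?m] less.prems by (force simp: strong_theta_free_def)
    then have len: "k + 2 \<le> length c" "2 * k \<le> length c + 3" by auto
    have "hd c \<in> V" "c \<noteq> []" using c(1) less.prems by (auto simp: strong_theta_free_def dicycle_def)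
    then have sub: "set c \<subseteq> V"
      using dipath_subset[of E c V] c(1) less.prems by (auto simp: strong_theta_free_def dicycle_def)
    show False
    proof (cases "set c = V")
      case True
      then show False
        using colourable_if_hamiltonian[OF less.prems _ c(1) True len IH] not by simp
    next
      case False
      then obtain o1 where "o1 \<in> V" "o1 \<notin> set c" using sub by blast
      then show False
        using colourable_if_outside[OF less.prems c(1) len(2) _ _ _ IH] not len less.prems(2)
        by simp
    qed
  qed
qed

section \<open>From thetas to subdivisions\<close>

definition arc_of :: "('a, 'b) pre_digraph \<Rightarrow> 'a \<times> 'a \<Rightarrow> 'b" where
  "arc_of G = inv_into (arcs G) (arc_to_ends G)"

abbreviation arc_walk :: "('a, 'b) pre_digraph \<Rightarrow> 'a list \<Rightarrow> 'b list" where
  "arc_walk G q \<equiv> map (arc_of G) (vwalk_arcs q)"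

lemma arc_of:
  assumes "(x, y) \<in> arcs_ends G"
  shows "arc_of G (x, y) \<in> arcs G" "tail G (arc_of G (x, y)) = x" "head G (arc_of G (x, y)) = y"
proof -
  have "arc_to_ends G (arc_of G (x, y)) = (x, y)" using assms
    by (simp add: arc_of_def arcs_ends_def f_inv_into_f)
  then show "tail G (arc_of G (x, y)) = x" "head G (arc_of G (x, y)) = y"
    by (simp_all add: arc_to_ends_def)
  show "arc_of G (x, y) \<in> arcs G" using assms
    by (simp add: arc_of_def arcs_ends_def inv_into_into)
qed

lemma arc_walk:
  assumes "tail H = tail G" "head H = head G" "dipath (arcs_ends G) q" "q \<noteq> []"
  shows "pre_digraph.awalk_verts H (hd q) (arc_walk G q) = q"
    and "pre_digraph.cas H (hd q) (arc_walk G q) (last q)"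
proof -
  interpret H: pre_digraph H .
  have "H.awalk_verts (hd q) (arc_walk G q) = q \<and> H.cas (hd q) (arc_walk G q) (last q)"
    using assms(3,4)
  proof (induction q rule: vwalk_arcs.induct)
    case (3 x y q)
    then have "(x, y) \<in> arcs_ends G" "dipath (arcs_ends G) (y # q)"
      by (auto simp: dipath_Cons)
    then show ?case using 3(1) assms(1,2) by (simp add: arc_of)
  qed auto
  then show "H.awalk_verts (hd q) (arc_walk G q) = q" "H.cas (hd q) (arc_walk G q) (last q)"
    by auto
qed

lemma two_block_cycle_simps:
  assumes "k \<ge> 1"
  shows "arcs (two_block_cycle k 1) = {(i, Suc i) | i. i < k} \<union> {(0, k)}"
    "verts (two_block_cycle k 1) = {..k}"
    "tail (two_block_cycle k 1) = fst" "head (two_block_cycle k 1) = snd"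
proof -
  have "set (vwalk_arcs [0..<k + 1]) = {(i, Suc i) | i. i < k}"
    unfolding vwalk_arcs_conv_nth by (auto simp del: upt_Suc intro!: exI)
  then show "arcs (two_block_cycle k 1) = {(i, Suc i) | i. i < k} \<union> {(0, k)}"
    by (simp add: two_block_cycle_def del: upt_Suc)
qed (auto simp: two_block_cycle_def)

text \<open>
  The first \<open>k\<close> vertices \<open>A\<close> of the long path and its end \<open>v\<close> are the branch vertices. So the
  first \<open>k - 1\<close> arcs of the block of length \<open>k\<close> stay single arcs, its last arc becomes the path
  \<open>C\<close>, that is, the rest of the long path from the last vertex of \<open>A\<close> on, and the arc \<open>(0, k)\<close>
  becomes the other path \<open>q\<close>.
\<close>
lemma subdivision_of_theta:
  fixes D :: "('a, 'b) pre_digraph"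
  assumes D: "digraph D" and k: "k \<ge> 2" and th: "theta k (arcs_ends D)"
  shows "\<exists>H. subgraph H D \<and> is_subdivision_of H (two_block_cycle k 1)"
proof -
  interpret D: digraph D by (rule D)
  obtain l where l: "k = Suc l" using k by (cases k) auto
  obtain u xs ys v where long: "dipath (arcs_ends D) (u # xs @ [v])"
    and q: "dipath (arcs_ends D) (u # ys @ [v])"
    and disj: "set xs \<inter> set ys = {}" and len: "k \<le> Suc (length xs)"
    using th unfolding theta_def by blast
  define A where "A = take k (u # xs)"
  define B where "B = drop k (u # xs)"
  have AB: "u # xs = A @ B" "length A = k" "A \<noteq> []" using len k by (auto simp: A_def B_def)
  then have hdA: "hd A = u" by (cases A) auto
  have p: "dipath (arcs_ends D) (A @ B @ [v])" using long AB(1) by (metis append.assoc append_Cons)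
  then have dist: "distinct (A @ B @ [v])" by (rule dipath_distinct)
  have "u \<in> set A" using hdA AB(3) by (metis list.set_sel(1))
  then have "u \<notin> set B" using dist by auto
  moreover have "insert u (set xs) = set A \<union> set B" using arg_cong[OF AB(1), of set] by simp
  ultimately have "set B \<subseteq> set xs" "set A \<subseteq> insert u (set xs)" by auto
  have disjB: "set B \<inter> set ys = {}" using \<open>set B \<subseteq> set xs\<close> disj by blast
  have Aq: "set A \<inter> set ys = {}" "v \<notin> set ys"
  proof -
    have "u \<notin> set ys" "v \<notin> set ys" using q by (auto simp: dipath_Cons dipath_append)
    then show "set A \<inter> set ys = {}" "v \<notin> set ys"
      using disj \<open>set A \<subseteq> insert u (set xs)\<close> by auto
  qed
  have ends: "arcs_ends D \<subseteq> verts D \<times> verts D" by (auto simp: arcs_ends_conv)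
  have "u \<in> verts D" using long ends by (cases xs) (auto simp: dipath_Cons)
  then have in_D: "set (u # xs @ [v]) \<subseteq> verts D" "set (u # ys @ [v]) \<subseteq> verts D"
    using dipath_subset[OF long ends] dipath_subset[OF q ends] by simp_all
  have set_ux: "set (u # xs) = set A \<union> set B" unfolding AB(1) by simp
  then have setp: "set (u # xs @ [v]) = set A \<union> set B \<union> {v}" by auto

  define C where "C = last A # B @ [v]"
  define q where "q = u # ys @ [v]"
  define \<phi> where "\<phi> i = (A @ [v]) ! i" for i
  define r where "r e = (if e = (0, k) then q
    else if Suc (fst e) < k then [A ! fst e, A ! Suc (fst e)] else C)" for e :: "nat \<times> nat"
  let ?F = "two_block_cycle k 1"
  have F: "arcs ?F = {(i, Suc i) | i. i < k} \<union> {(0, k)}" "verts ?F = {..k}"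
    "tail ?F = fst" "head ?F = snd" using two_block_cycle_simps[of k] k by auto
  have A_path: "dipath (arcs_ends D) A" using p by (simp add: dipath_append)
  have lastA: "A ! (l) = last A" using AB l by (simp add: last_conv_nth)
  have C_path: "dipath (arcs_ends D) C"
  proof -
    have "A @ B @ [v] = butlast A @ C" using AB(3) by (simp add: C_def)
    then show ?thesis using p by (simp add: dipath_append)
  qed
  have q_path: "dipath (arcs_ends D) q" using \<open>dipath _ (u # ys @ [v])\<close> by (simp add: q_def)
  have cases_F: "Q e" if "e \<in> arcs ?F" "Q (0, k)" "\<And>i. Suc i < k \<Longrightarrow> Q (i, Suc i)" "Q (l, k)"
    for Q and e :: "nat \<times> nat"
  proof -
    from that(1) F(1) consider "e = (0, k)" | i where "e = (i, Suc i)" "i < k" by auto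
    then show ?thesis
    proof cases
      case (2 i)
      show ?thesis
      proof (cases "Suc i < k")
        case False
        with 2 l have "e = (l, k)" by simp
        with that(4) show ?thesis by simp
      qed (use 2 that(3) in simp)
    qed (use that(2) in simp)
  qed
  have r: "r (0, k) = q" "r (l, k) = C" "\<And>i. Suc i < k \<Longrightarrow> r (i, Suc i) = [A ! i, A ! Suc i]"
    using k l by (auto simp: r_def)
  have \<phi>: "\<phi> 0 = u" "\<phi> k = v" "\<phi> (l) = last A" "\<And>i. i < k \<Longrightarrow> \<phi> i = A ! i"
    using AB hdA l lastA by (auto simp: \<phi>_def nth_append hd_conv_nth)
  have r_path: "dipath (arcs_ends D) (r e) \<and> hd (r e) = \<phi> (fst e) \<and> last (r e) = \<phi> (snd e)
      \<and> 2 \<le> length (r e)" if "e \<in> arcs ?F" for e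
    using that
  proof (rule cases_F)
    fix i assume i: "Suc i < k"
    then have "(A ! i, A ! Suc i) \<in> arcs_ends D" "A ! i \<noteq> A ! Suc i"
      using A_path AB(2) by (auto simp: dipath_def successively_conv_nth nth_eq_iff_index_eq)
    then show "dipath (arcs_ends D) (r (i, Suc i)) \<and> hd (r (i, Suc i)) = \<phi> (fst (i, Suc i))
      \<and> last (r (i, Suc i)) = \<phi> (snd (i, Suc i)) \<and> 2 \<le> length (r (i, Suc i))"
      using i by (simp add: r \<phi> dipath_Cons)
  qed (simp_all add: r \<phi> q_path C_path, simp_all add: q_def C_def)
  define H where "H = \<lparr>verts = \<phi> ` verts ?F \<union> (\<Union>e \<in> arcs ?F. set (r e)),
    arcs = (\<Union>e \<in> arcs ?F. set (arc_walk D (r e))), tail = tail D, head = head D\<rparr>"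
  have H: "verts H = \<phi> ` verts ?F \<union> (\<Union>e \<in> arcs ?F. set (r e))"
    "arcs H = (\<Union>e \<in> arcs ?F. set (arc_walk D (r e)))"
    "tail H = tail D" "head H = head D" by (simp_all add: H_def)
  interpret H: pre_digraph H .
  have set\<phi>: "\<phi> ` {..k} = set A \<union> {v}"
  proof -
    have "\<phi> ` {..k} = (!) (A @ [v]) ` {0..<length (A @ [v])}" using AB(2)
      by (intro image_cong) (auto simp: \<phi>_def)
    then show ?thesis using nth_image[of "length (A @ [v])" "A @ [v]"] by simp
  qed
  have r_in: "set (r e) \<subseteq> set A \<union> set B \<union> {v} \<union> set (u # ys @ [v])" if "e \<in> arcs ?F" for e
    using that by (rule cases_F) (use AB k in \<open>auto simp: r q_def C_def\<close>)
  have arcs_H: "e \<in> arcs D \<and> tail D e \<in> verts H \<and> head D e \<in> verts H" if "e \<in> arcs H" for e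
  proof -
    from that obtain a i where a: "a \<in> arcs ?F" and i: "Suc i < length (r a)"
      and e: "e = arc_of D (r a ! i, r a ! Suc i)"
      unfolding H(2) set_map vwalk_arcs_conv_nth by blast
    have "(r a ! i, r a ! Suc i) \<in> arcs_ends D"
      using r_path[OF a] i by (auto simp: dipath_def successively_conv_nth)
    moreover have "set (r a) \<subseteq> verts H" using a by (auto simp: H(1))
    then have "r a ! i \<in> verts H" "r a ! Suc i \<in> verts H" using i by (simp_all add: subset_iff)
    ultimately show ?thesis unfolding e by (simp add: arc_of)
  qed
  have "wf_digraph H" using arcs_H by unfold_locales (auto simp: H(3,4))
  moreover have "verts H \<subseteq> verts D"
    using r_in in_D set\<phi> setp unfolding H(1) F(2) by blast
  ultimately have sub: "subgraph H D" using arcs_H D.wf_digraph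
    by (auto simp: subgraph_def compatible_def H(3,4))
  have walk: "H.awalk_verts (\<phi> (fst e)) (arc_walk D (r e)) = r e"
    "H.apath (\<phi> (fst e)) (arc_walk D (r e)) (\<phi> (snd e))" if e: "e \<in> arcs ?F" for e
  proof -
    have ne: "r e \<noteq> []" using r_path[OF e] by auto
    show v: "H.awalk_verts (\<phi> (fst e)) (arc_walk D (r e)) = r e"
      using arc_walk(1)[OF H(3,4) _ ne] r_path[OF e] by simp
    show "H.apath (\<phi> (fst e)) (arc_walk D (r e)) (\<phi> (snd e))"
      unfolding H.apath_def H.awalk_def v
      using arc_walk(2)[OF H(3,4) _ ne] r_path[OF e] e ne F(1,2)
      by (auto simp: H(1,2) dipath_def intro!: imageI)
  qed
  have internal: "internal_verts H (\<phi> (fst e)) (arc_walk D (r e)) = set (butlast (tl (r e)))"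
    if "e \<in> arcs ?F" for e
    using walk(1)[OF that] by (simp add: internal_verts_def)
  have tl_r: "set (butlast (tl (r (0, k)))) = set ys" "set (butlast (tl (r (l, k)))) = set B"
    "\<And>i. Suc i < k \<Longrightarrow> set (butlast (tl (r (i, Suc i)))) = {}"
    by (simp_all add: r q_def C_def)
  have "inj_on \<phi> (verts ?F)"
  proof -
    have "distinct (A @ [v])" using dist by auto
    then show ?thesis using AB(2) unfolding F(2) \<phi>_def by (intro inj_onI) (auto simp: nth_eq_iff_index_eq)
  qed
  moreover have "H.apath (\<phi> (fst e)) (arc_walk D (r e)) (\<phi> (snd e)) \<and> 1 \<le> length (arc_walk D (r e)) \<and>
      internal_verts H (\<phi> (fst e)) (arc_walk D (r e)) \<inter> \<phi> ` verts ?F = {}" if e: "e \<in> arcs ?F" for e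
  proof -
    have "length (vwalk_arcs (r e)) \<ge> 1" using r_path[OF e] by (cases "r e" rule: vwalk_arcs.cases) auto
    moreover have "set (butlast (tl (r e))) \<inter> (set A \<union> {v}) = {}"
      using e by (rule cases_F) (use Aq dist in \<open>auto simp: tl_r\<close>)
    ultimately show ?thesis using walk(2)[OF e] unfolding internal[OF e] F(2) set\<phi> by simp
  qed
  moreover have "internal_verts H (\<phi> (fst a)) (arc_walk D (r a)) \<inter>
      internal_verts H (\<phi> (fst b)) (arc_walk D (r b)) = {}"
    if "a \<in> arcs ?F" "b \<in> arcs ?F" "a \<noteq> b" for a b
  proof -
    have "a \<noteq> b \<longrightarrow> set (butlast (tl (r a))) \<inter> set (butlast (tl (r b))) = {}"
      using that(1)
    proof (rule cases_F)
      show "(0, k) \<noteq> b \<longrightarrow> set (butlast (tl (r (0, k)))) \<inter> set (butlast (tl (r b))) = {}"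
        using that(2) by (rule cases_F) (use disjB in \<open>auto simp: tl_r\<close>)
      show "(l, k) \<noteq> b \<longrightarrow> set (butlast (tl (r (l, k)))) \<inter> set (butlast (tl (r b))) = {}"
        using that(2) by (rule cases_F) (use disjB in \<open>auto simp: tl_r\<close>)
    qed (simp add: tl_r)
    then show ?thesis using that by (simp add: internal)
  qed
  moreover have "verts H = \<phi> ` verts ?F \<union> (\<Union>e \<in> arcs ?F. internal_verts H (\<phi> (fst e)) (arc_walk D (r e)))"
  proof -
    have "set (r e) \<subseteq> \<phi> ` verts ?F \<union> set (butlast (tl (r e)))" if e: "e \<in> arcs ?F" for e
    proof -
      have "set (r e) = {\<phi> (fst e), \<phi> (snd e)} \<union> set (butlast (tl (r e)))"
        using e by (rule cases_F) (auto simp: tl_r, auto simp: r \<phi> q_def C_def)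
      then show ?thesis using e F(1,2) by auto
    qed
    moreover have "set (butlast (tl (r e))) \<subseteq> set (r e)" for e
      by (cases "r e") (auto dest: in_set_butlastD)
    ultimately show ?thesis unfolding H(1) using internal by auto blast+
  qed
  ultimately have "is_subdivision_of H ?F"
    unfolding is_subdivision_of_def F(3,4)
    using D.digraph_subgraph[OF sub] digraph_two_block_cycle[of k 1] k H(2)
    by (intro conjI exI[of _ \<phi>] exI[of _ "\<lambda>e. arc_walk D (r e)"] ballI impI) auto
  with sub show ?thesis by blast
qed

theorem corollary32:
  fixes k :: nat
  assumes "k > 1"
  shows "class_chromatic_number
           ((S_Forb (two_block_cycle k 1) :: ('a, 'b) pre_digraph set) \<inter> strong_digraphs)
         \<le> enat (max (k + 1) (2 * k - 4))"
  unfolding class_chromatic_number_le_iff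
proof
  fix D :: "('a, 'b) pre_digraph"
  assume "D \<in> S_Forb (two_block_cycle k 1) \<inter> strong_digraphs"
  then have D: "digraph D" "strongly_connected D"
    and free: "\<not> (\<exists>H. subgraph H D \<and> is_subdivision_of H (two_block_cycle k 1))"
    by (auto simp: S_Forb_def strong_digraphs_def)
  interpret D: digraph D by (rule D)
  have "strong_theta_free k (verts D) (arcs_ends D)"
    unfolding strong_theta_free_def
  proof (intro conjI)
    show "strong_on (verts D) (arcs_ends D)" using D(2)
      by (auto simp: strong_on_def strongly_connected_def reachable_def intro: rtrancl_on_rtranclI)
    have "2 \<le> k" using assms by simp
    then show "\<not> theta k (arcs_ends D)" using subdivision_of_theta[OF D(1)] free by blast
  qed (auto simp: arcs_ends_conv irrefl_def dest: D.no_loops)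
  then have "colourable (verts D) (arcs_ends D) (max (k + 1) (2 * k - 4))"
    using assms by (intro strong_theta_free_colourable) auto
  then obtain c where c: "\<And>v. v \<in> verts D \<Longrightarrow> c v < max (k + 1) (2 * k - 4)"
    "\<And>u v. (u, v) \<in> arcs_ends D \<Longrightarrow> c u \<noteq> c v"
    unfolding colourable_def by blast
  have "c (tail D e) \<noteq> c (head D e)" if "e \<in> arcs D" for e
    using that by (intro c(2)) (auto simp: arcs_ends_conv)
  then have "proper_colouring (with_proj (mk_symmetric D)) (max (k + 1) (2 * k - 4)) c"
    using c(1) unfolding proper_colouring_def by (auto simp: parcs_mk_symmetric) metis
  then have "\<exists>c. proper_colouring (with_proj (mk_symmetric D)) (max (k + 1) (2 * k - 4)) c" by blast
  then show "chromatic_number D \<le> max (k + 1) (2 * k - 4)"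
    unfolding chromatic_number_def by (rule Least_le)
qed

end
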